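(* Let $F$ be a field of characteristic zero and consider the subalgebras $M_1=Fe_{22}\oplus Fe_{12}$ and $M_2=Fe_{11}\oplus Fe_{12}$ of the algebra of $2\times 2$ matrices over $F$ ($e_{ij}$ are the matrix units). Let $\delta$ denote the derivation of $M_1$ given by $\delta(\alpha e_{22}+\beta e_{12})=\alpha e_{12}$, and also the derivation of $M_2$ given by $\delta(\alpha e_{11}+\beta e_{12})=\alpha e_{12}$, for all $\alpha,\beta\in F$. Let $L=F\delta$ be the one-dimensional Lie algebra spanned by $\delta$, and let $M_1^\delta$, $M_2^\delta$ denote $M_1$, $M_2$ regarded as $L$-algebras via these derivations. Then: (1) $\mathrm{Id}^L(M_1^\delta)=\langle x[y,z],\ x^\delta y-y^\delta x,\ xy^\delta,\ x^{\delta^2}\rangle_{T_L}$ and $\mathrm{Id}^L(M_2^\delta)=\langle [x,y]z,\ xy^\delta-yx^\delta,\ x^\delta y,\ x^{\delta^2}\rangle_{T_L}$; (2) $c_n^L(M_1^\delta)=c_n^L(M_2^\delta)=n+1$ for all $n\ge 1$; (3) $\chi_n^L(M_1^\delta)=\chi_n^L(M_2^\delta)=2\chi_{(n)}+\chi_{(n-1,1)}$ for all $n\ge 1$, where the term $\chi_{(n-1,1)}$ is omitted if $n=1$.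
   Context: An $L$-algebra is an associative algebra $A$ over $F$ (not necessarily unital) on which a Lie algebra $L$ acts by derivations; the action extends to the universal enveloping algebra $U(L)$, products acting by composition, i.e. $(gh)(a)=g(h(a))$. Fix a basis $\mathcal B\ni 1$ of $U(L)$. $F\langle X|L\rangle$ is the free associative algebra (without constant terms) on the free generators $x_j^{h}$, $h\in\mathcal B$, $j\in\mathbb N$; one writes $x_j=x_j^1$ and extends $x_j^h$ linearly to all $h\in U(L)$. $U(L)$ acts on it with each $\gamma\in L$ acting as the derivation with $\gamma(x_j^h)=x_j^{\gamma h}$; for a polynomial $f$ and $h\in U(L)$, $f^h=h(f)$. Elements are differential polynomials; $f(x_1,\dots,x_n)$ is a differential identity of $A$ if it vanishes under all substitutions $x_i\mapsto a_i\in A$ (with $x_i^h\mapsto h(a_i)$). $\mathrm{Id}^L(A)$ is the set of differential identities of $A$. A $T_L$-ideal is a two-sided ideal of $F\langle X|L\rangle$ stable under the $U(L)$-action and under all substitutions $x_j\mapsto g_j\in F\langle X|L\rangle$ (with $x_j^h\mapsto h(g_j)$); $\langle S\rangle_{T_L}$ is the $T_L$-ideal generated by $S$. Letters $x,y,z$ denote distinct variables of $X=\{x_1,x_2,\dots\}$, and $[x,y]=xy-yx$. $P_n^L=\mathrm{span}_F\{x_{\sigma(1)}^{h_1}\cdots x_{\sigma(n)}^{h_n}\mid \sigma\in S_n,\ h_i\in\mathcal B\}$ is the space of multilinear differential polynomials in $x_1,\dots,x_n$, with $S_n$ acting by $\sigma(x_i^h)=x_{\sigma(i)}^h$. The $n$th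 differential codimension is $c_n^L(A)=\dim_F P_n^L/(P_n^L\cap \mathrm{Id}^L(A))$ and the $n$th differential cocharacter $\chi_n^L(A)$ is the $S_n$-character of this quotient. For $\lambda\vdash n$, $\chi_\lambda$ is the irreducible $S_n$-character associated to $\lambda$. *)

theory Defs
  imports
    "HOL-Library.Poly_Mapping"
    "HOL-Computational_Algebra.Polynomial"
    "HOL-Combinatorics.Permutations"
    "HOL-Analysis.Cartesian_Space"
begin

section \<open>Algebras with an action of the one-dimensional Lie algebra\<close>

text \<open>
  Throughout, L is the one-dimensional (hence abelian) Lie algebra with basis \<open>\<delta>\<close>. Its universal
  enveloping algebra is the tensor algebra of L modulo the zero ideal, that is, the algebra of
  polynomials in \<open>\<delta>\<close>; it is represented by the type \<open>'f poly\<close>, with \<open>\<delta>\<close> the polynomial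
  \<open>[:0, 1:]\<close>. An action of L by derivations on A is the same as one derivation of A, the image
  of \<open>\<delta>\<close>.
\<close>

abbreviation delta :: "'f::field_char_0 poly" where
  "delta \<equiv> [:0, 1:]"

text \<open>
  The algebra structure lives on a subset \<open>carr\<close> of an abelian group, so that subalgebras and
  nonunital algebras are covered, and the product need not be the type-class product.
\<close>

record ('f, 'a) L_alg =
  carr :: "'a set"
  scl  :: "'f \<Rightarrow> 'a \<Rightarrow> 'a"
  mul  :: "'a \<Rightarrow> 'a \<Rightarrow> 'a"
  der  :: "'a \<Rightarrow> 'a"

locale L_algebra =
  fixes A :: "('f::field_char_0, 'a::ab_group_add) L_alg"
  assumes scl_vector_space: "vector_space (scl A)"
    and carr_subspace: "module.subspace (scl A) (carr A)"
    and mul_closed: "\<lbrakk>a \<in> carr A; b \<in> carr A\<rbrakk> \<Longrightarrow> mul A a b \<in> carr A"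
    and mul_assoc: "\<lbrakk>a \<in> carr A; b \<in> carr A; c \<in> carr A\<rbrakk>
          \<Longrightarrow> mul A (mul A a b) c = mul A a (mul A b c)"
    and mul_add_left: "\<lbrakk>a \<in> carr A; b \<in> carr A; c \<in> carr A\<rbrakk>
          \<Longrightarrow> mul A (a + b) c = mul A a c + mul A b c"
    and mul_add_right: "\<lbrakk>a \<in> carr A; b \<in> carr A; c \<in> carr A\<rbrakk>
          \<Longrightarrow> mul A a (b + c) = mul A a b + mul A a c"
    and mul_scl_left: "\<lbrakk>a \<in> carr A; b \<in> carr A\<rbrakk> \<Longrightarrow> mul A (scl A k a) b = scl A k (mul A a b)"
    and mul_scl_right: "\<lbrakk>a \<in> carr A; b \<in> carr A\<rbrakk> \<Longrightarrow> mul A a (scl A k b) = scl A k (mul A a b)"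
    and der_closed: "a \<in> carr A \<Longrightarrow> der A a \<in> carr A"
    and der_add: "\<lbrakk>a \<in> carr A; b \<in> carr A\<rbrakk> \<Longrightarrow> der A (a + b) = der A a + der A b"
    and der_scl: "a \<in> carr A \<Longrightarrow> der A (scl A k a) = scl A k (der A a)"
    and der_mul: "\<lbrakk>a \<in> carr A; b \<in> carr A\<rbrakk>
          \<Longrightarrow> der A (mul A a b) = mul A (der A a) b + mul A a (der A b)"

definition U_act :: "('f::field_char_0, 'a::ab_group_add) L_alg \<Rightarrow> 'f poly \<Rightarrow> 'a \<Rightarrow> 'a" where
  "U_act A h a = (\<Sum>k\<le>degree h. scl A (coeff h k) ((der A ^^ k) a))"


section \<open>The free differential algebra\<close>

datatype 'x nc_word = NCWord (letters: "'x list")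

instantiation nc_word :: (type) monoid_add
begin

definition zero_nc_word :: "'a nc_word" where
  "0 = NCWord []"

definition plus_nc_word :: "'a nc_word \<Rightarrow> 'a nc_word \<Rightarrow> 'a nc_word" where
  "u + v = NCWord (letters u @ letters v)"

instance
  by standard (simp_all add: zero_nc_word_def plus_nc_word_def)

end

text \<open>
  With words as (additively written) exponents, the product of \<open>'x nc_word \<Rightarrow>\<^sub>0 'f\<close> is the
  one of the free associative algebra. The letter \<open>(j, b)\<close> stands for the free generator
  \<open>x\<^sub>j\<close> with exponent b; only exponents b from the chosen basis of U(L) are admitted in
  \<open>free_L_alg\<close> below. Variables are numbered from 0.
\<close>

type_synonym 'f diff_poly = "(nat \<times> 'f poly) nc_word \<Rightarrow>\<^sub>0 'f"

definition pm_scale :: "'f::field_char_0 \<Rightarrow> ('k \<Rightarrow>\<^sub>0 'f) \<Rightarrow> ('k \<Rightarrow>\<^sub>0 'f)" where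
  "pm_scale c p = Poly_Mapping.map ((*) c) p"

text \<open>Linear extension of a map given on basis elements:\<close>

definition lin_ext :: "('f::field_char_0 \<Rightarrow> 'a \<Rightarrow> 'a) \<Rightarrow> ('k \<Rightarrow> 'a) \<Rightarrow> ('k \<Rightarrow>\<^sub>0 'f) \<Rightarrow> 'a::ab_group_add"
  where "lin_ext s g p = (\<Sum>w\<in>Poly_Mapping.keys p. s (Poly_Mapping.lookup p w) (g w))"

definition U_basis :: "'f::field_char_0 poly set \<Rightarrow> bool" where
  "U_basis B \<longleftrightarrow> 1 \<in> B \<and> \<not> module.dependent smult B \<and> module.span smult B = UNIV"

text \<open>The element \<open>x\<^sub>j\<close> with exponent an arbitrary h in U(L), by expanding h in the basis:\<close>

definition dvar :: "'f::field_char_0 poly set \<Rightarrow> nat \<Rightarrow> 'f poly \<Rightarrow> 'f diff_poly" where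
  "dvar B j h = (\<Sum>b | module.representation smult B h b \<noteq> 0.
      Poly_Mapping.single (NCWord [(j, b)]) (module.representation smult B h b))"

definition word_der :: "'f::field_char_0 poly set \<Rightarrow> (nat \<times> 'f poly) nc_word \<Rightarrow> 'f diff_poly" where
  "word_der B w = (let xs = letters w in \<Sum>i<length xs.
      Poly_Mapping.single (NCWord (take i xs)) 1
      * dvar B (fst (xs ! i)) (delta * snd (xs ! i))
      * Poly_Mapping.single (NCWord (drop (Suc i) xs)) 1)"

definition free_L_alg :: "'f::field_char_0 poly set \<Rightarrow> ('f, 'f diff_poly) L_alg" where
  "free_L_alg B =
    \<lparr>carr = {f. \<forall>w\<in>Poly_Mapping.keys f. letters w \<noteq> [] \<and> snd ` set (letters w) \<subseteq> B},
     scl = pm_scale,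
     mul = (*),
     der = lin_ext pm_scale (word_der B)\<rparr>"


section \<open>Substitutions, differential identities and T-ideals\<close>

text \<open>Product of a nonempty list; the value at the empty list is irrelevant.\<close>

fun nprod :: "('a \<Rightarrow> 'a \<Rightarrow> 'a) \<Rightarrow> 'a list \<Rightarrow> 'a::zero" where
  "nprod m [] = 0"
| "nprod m [a] = a"
| "nprod m (a # b # r) = m a (nprod m (b # r))"

definition diff_subst ::
  "('f::field_char_0, 'a::ab_group_add) L_alg \<Rightarrow> (nat \<Rightarrow> 'a) \<Rightarrow> 'f diff_poly \<Rightarrow> 'a" where
  "diff_subst A \<phi> f =
    lin_ext (scl A) (\<lambda>w. nprod (mul A) (map (\<lambda>(j, h). U_act A h (\<phi> j)) (letters w))) f"

definition diff_Id ::
  "'f::field_char_0 poly set \<Rightarrow> ('f, 'a::ab_group_add) L_alg \<Rightarrow> 'f diff_poly set" where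
  "diff_Id B A =
    {f \<in> carr (free_L_alg B). \<forall>\<phi>. (\<forall>j. \<phi> j \<in> carr A) \<longrightarrow> diff_subst A \<phi> f = 0}"

definition TL_ideal :: "'f::field_char_0 poly set \<Rightarrow> 'f diff_poly set \<Rightarrow> bool" where
  "TL_ideal B I \<longleftrightarrow>
     I \<subseteq> carr (free_L_alg B) \<and> module.subspace pm_scale I \<and>
     (\<forall>f\<in>I. \<forall>g\<in>carr (free_L_alg B). f * g \<in> I \<and> g * f \<in> I) \<and>
     (\<forall>f\<in>I. \<forall>h. U_act (free_L_alg B) h f \<in> I) \<and>
     (\<forall>f\<in>I. \<forall>\<phi>. (\<forall>j. \<phi> j \<in> carr (free_L_alg B)) \<longrightarrow> diff_subst (free_L_alg B) \<phi> f \<in> I)"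

definition TL_generated :: "'f::field_char_0 poly set \<Rightarrow> 'f diff_poly set \<Rightarrow> 'f diff_poly set" where
  "TL_generated B S = \<Inter>{I. TL_ideal B I \<and> S \<subseteq> I}"


section \<open>Dimension and trace on a quotient space\<close>

text \<open>
  For subspaces \<open>W \<subseteq> V\<close>, a list of elements of V whose cosets form a (finite) basis of V/W:
\<close>

definition quot_basis ::
  "('f::field_char_0 \<Rightarrow> 'v \<Rightarrow> 'v) \<Rightarrow> 'v set \<Rightarrow> 'v set \<Rightarrow> 'v::ab_group_add list \<Rightarrow> bool" where
  "quot_basis s V W vs \<longleftrightarrow> set vs \<subseteq> V \<and>
     (\<forall>v\<in>V. \<exists>c. v - (\<Sum>i<length vs. s (c i) (vs ! i)) \<in> W) \<and>
     (\<forall>c. (\<Sum>i<length vs. s (c i) (vs ! i)) \<in> W \<longrightarrow> (\<forall>i<length vs. c i = 0))"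

text \<open>Unspecified if V/W is not finite-dimensional:\<close>

definition quot_dim ::
  "('f::field_char_0 \<Rightarrow> 'v \<Rightarrow> 'v) \<Rightarrow> 'v set \<Rightarrow> 'v::ab_group_add set \<Rightarrow> nat" where
  "quot_dim s V W = (THE k. \<exists>vs. quot_basis s V W vs \<and> length vs = k)"

definition quot_coord ::
  "('f::field_char_0 \<Rightarrow> 'v \<Rightarrow> 'v) \<Rightarrow> 'v set \<Rightarrow> 'v::ab_group_add list \<Rightarrow> 'v \<Rightarrow> nat \<Rightarrow> 'f" where
  "quot_coord s W vs v = (SOME c. v - (\<Sum>i<length vs. s (c i) (vs ! i)) \<in> W)"

text \<open>Trace of the endomorphism of V/W induced by a linear map T preserving V and W:\<close>

definition quot_trace ::
  "('f::field_char_0 \<Rightarrow> 'v \<Rightarrow> 'v) \<Rightarrow> 'v set \<Rightarrow> 'v set \<Rightarrow> ('v::ab_group_add \<Rightarrow> 'v) \<Rightarrow> 'f" where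
  "quot_trace s V W T = (let vs = (SOME vs. quot_basis s V W vs)
     in \<Sum>i<length vs. quot_coord s W vs (T (vs ! i)) i)"


section \<open>Differential codimensions and cocharacters\<close>

text \<open>The symmetric group on n letters is the group of permutations of \<open>{..<n}\<close>.\<close>

definition multilin :: "'f::field_char_0 poly set \<Rightarrow> nat \<Rightarrow> 'f diff_poly set" where
  "multilin B n = module.span pm_scale
     {Poly_Mapping.single (NCWord (map (\<lambda>i. (\<sigma> i, h i)) [0..<n])) 1 | \<sigma> h.
        \<sigma> permutes {..<n} \<and> (\<forall>i<n. h i \<in> B)}"

definition perm_act :: "(nat \<Rightarrow> nat) \<Rightarrow> 'f::field_char_0 diff_poly \<Rightarrow> 'f diff_poly" where
  "perm_act \<sigma> = lin_ext pm_scale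
     (\<lambda>w. Poly_Mapping.single (NCWord (map (\<lambda>(j, h). (\<sigma> j, h)) (letters w))) 1)"

definition diff_codim ::
  "'f::field_char_0 poly set \<Rightarrow> ('f, 'a::ab_group_add) L_alg \<Rightarrow> nat \<Rightarrow> nat" where
  "diff_codim B A n = quot_dim pm_scale (multilin B n) (multilin B n \<inter> diff_Id B A)"

definition diff_cochar ::
  "'f::field_char_0 poly set \<Rightarrow> ('f, 'a::ab_group_add) L_alg \<Rightarrow> nat \<Rightarrow> (nat \<Rightarrow> nat) \<Rightarrow> 'f" where
  "diff_cochar B A n \<sigma> =
     quot_trace pm_scale (multilin B n) (multilin B n \<inter> diff_Id B A) (perm_act \<sigma>)"


section \<open>Irreducible characters of the symmetric group\<close>

text \<open>
  A partition of n is a weakly decreasing list of positive integers with sum n. Its Young diagram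
  is filled with \<open>0, \<dots>, n - 1\<close> row by row; \<open>tab_row\<close> and \<open>tab_col\<close> give the position of an entry
  (counted from 0) in this tableau.
\<close>

definition tab_row :: "nat list \<Rightarrow> nat \<Rightarrow> nat" where
  "tab_row lam m = (LEAST r. m < sum_list (take (Suc r) lam))"

definition tab_col :: "nat list \<Rightarrow> nat \<Rightarrow> nat" where
  "tab_col lam m = m - sum_list (take (tab_row lam m) lam)"

definition row_stab :: "nat list \<Rightarrow> (nat \<Rightarrow> nat) set" where
  "row_stab lam = {\<sigma>. \<sigma> permutes {..<sum_list lam} \<and>
     (\<forall>m<sum_list lam. tab_row lam (\<sigma> m) = tab_row lam m)}"

definition col_stab :: "nat list \<Rightarrow> (nat \<Rightarrow> nat) set" where
  "col_stab lam = {\<tau>. \<tau> permutes {..<sum_list lam} \<and>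
     (\<forall>m<sum_list lam. tab_col lam (\<tau> m) = tab_col lam m)}"

text \<open>
  Elements of the group algebra of the symmetric group are elements of \<open>(nat \<Rightarrow> nat) \<Rightarrow>\<^sub>0 'f\<close>
  supported on permutations of \<open>{..<n}\<close>.
\<close>

definition young_symmetrizer :: "nat list \<Rightarrow> ((nat \<Rightarrow> nat) \<Rightarrow>\<^sub>0 'f::field_char_0)" where
  "young_symmetrizer lam = (\<Sum>\<sigma>\<in>row_stab lam. \<Sum>\<tau>\<in>col_stab lam.
     Poly_Mapping.single (\<sigma> \<circ> \<tau>) (of_int (sign \<tau>)))"

definition left_mult :: "(nat \<Rightarrow> nat) \<Rightarrow> ((nat \<Rightarrow> nat) \<Rightarrow>\<^sub>0 'f::field_char_0) \<Rightarrow> ((nat \<Rightarrow> nat) \<Rightarrow>\<^sub>0 'f)" where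
  "left_mult \<rho> = lin_ext pm_scale (\<lambda>\<pi>. Poly_Mapping.single (\<rho> \<circ> \<pi>) 1)"

text \<open>The left ideal of the group algebra generated by the Young symmetrizer, and its character:\<close>

definition irr_module :: "nat list \<Rightarrow> ((nat \<Rightarrow> nat) \<Rightarrow>\<^sub>0 'f::field_char_0) set" where
  "irr_module lam = module.span pm_scale
     {left_mult \<rho> (young_symmetrizer lam) | \<rho>. \<rho> permutes {..<sum_list lam}}"

definition irr_char :: "nat list \<Rightarrow> (nat \<Rightarrow> nat) \<Rightarrow> 'f::field_char_0" where
  "irr_char lam \<sigma> = quot_trace pm_scale (irr_module lam) {0} (left_mult \<sigma>)"


section \<open>The two algebras\<close>

definition mat_unit :: "2 \<Rightarrow> 2 \<Rightarrow> 'f::field_char_0^2^2" where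
  "mat_unit i j = (\<chi> k l. if k = i \<and> l = j then 1 else 0)"

definition mat_scale :: "'f::field_char_0 \<Rightarrow> 'f^2^2 \<Rightarrow> 'f^2^2" where
  "mat_scale c A = (\<chi> k l. c * A $ k $ l)"

definition M1_delta :: "('f::field_char_0, 'f^2^2) L_alg" where
  "M1_delta =
    \<lparr>carr = {mat_scale \<alpha> (mat_unit 2 2) + mat_scale \<beta> (mat_unit 1 2) | \<alpha> \<beta>. True},
     scl = mat_scale,
     mul = (**),
     der = (\<lambda>A. mat_scale (A $ 2 $ 2) (mat_unit 1 2))\<rparr>"

definition M2_delta :: "('f::field_char_0, 'f^2^2) L_alg" where
  "M2_delta =
    \<lparr>carr = {mat_scale \<alpha> (mat_unit 1 1) + mat_scale \<beta> (mat_unit 1 2) | \<alpha> \<beta>. True},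
     scl = mat_scale,
     mul = (**),
     der = (\<lambda>A. mat_scale (A $ 1 $ 1) (mat_unit 1 2))\<rparr>"

lemma M1_delta_der:
  "der M1_delta (mat_scale \<alpha> (mat_unit 2 2) + mat_scale \<beta> (mat_unit 1 2))
     = mat_scale \<alpha> (mat_unit 1 2)"
  by (simp add: M1_delta_def mat_unit_def mat_scale_def)

lemma M2_delta_der:
  "der M2_delta (mat_scale \<alpha> (mat_unit 1 1) + mat_scale \<beta> (mat_unit 1 2))
     = mat_scale \<alpha> (mat_unit 1 2)"
  by (simp add: M2_delta_def mat_unit_def mat_scale_def)

lemma vector_space_mat_scale: "vector_space mat_scale"
  by unfold_locales (simp_all add: mat_scale_def vec_eq_iff algebra_simps)

lemma mem_M1_delta: "A \<in> carr M1_delta \<longleftrightarrow> A $ 1 $ 1 = 0 \<and> A $ 2 $ 1 = 0"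
proof
  assume "A $ 1 $ 1 = 0 \<and> A $ 2 $ 1 = 0"
  then have "A = mat_scale (A $ 2 $ 2) (mat_unit 2 2) + mat_scale (A $ 1 $ 2) (mat_unit 1 2)"
    by (simp add: mat_scale_def mat_unit_def vec_eq_iff forall_2)
  then show "A \<in> carr M1_delta"
    unfolding M1_delta_def by auto
qed (auto simp: M1_delta_def mat_scale_def mat_unit_def)

lemma mem_M2_delta: "A \<in> carr M2_delta \<longleftrightarrow> A $ 2 $ 1 = 0 \<and> A $ 2 $ 2 = 0"
proof
  assume "A $ 2 $ 1 = 0 \<and> A $ 2 $ 2 = 0"
  then have "A = mat_scale (A $ 1 $ 1) (mat_unit 1 1) + mat_scale (A $ 1 $ 2) (mat_unit 1 2)"
    by (simp add: mat_scale_def mat_unit_def vec_eq_iff forall_2)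
  then show "A \<in> carr M2_delta"
    unfolding M2_delta_def by auto
qed (auto simp: M2_delta_def mat_scale_def mat_unit_def)

lemma M1_delta_L_algebra: "L_algebra M1_delta"
proof -
  interpret vector_space "mat_scale :: 'a \<Rightarrow> _" by (rule vector_space_mat_scale)
  have "subspace (carr M1_delta)"
    by (simp add: subspace_def mem_M1_delta mat_scale_def)
  then show ?thesis
    using vector_space_mat_scale
    by unfold_locales
      (auto simp: mem_M1_delta, simp_all add: M1_delta_def mat_unit_def mat_scale_def
        matrix_matrix_mult_def vec_eq_iff forall_2 sum_2 algebra_simps)
qed

lemma M2_delta_L_algebra: "L_algebra M2_delta"
proof -
  interpret vector_space "mat_scale :: 'a \<Rightarrow> _" by (rule vector_space_mat_scale)
  have "subspace (carr M2_delta)"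
    by (simp add: subspace_def mem_M2_delta mat_scale_def)
  then show ?thesis
    using vector_space_mat_scale
    by unfold_locales
      (auto simp: mem_M2_delta, simp_all add: M2_delta_def mat_unit_def mat_scale_def
        matrix_matrix_mult_def vec_eq_iff forall_2 sum_2 algebra_simps)
qed

end

theory Submission
  imports Defs
begin

text \<open>
  Write \<open>\<chi> a\<close> for the \<open>e\<^sub>2\<^sub>2\<close>-coordinate of an element a of \<open>M\<^sub>1\<close>. The multiplication of \<open>M\<^sub>1\<close> is
  \<open>a b = \<chi>(b) a\<close>, and the derivation is \<open>\<delta> a = \<chi>(a) e\<^sub>1\<^sub>2\<close>; in particular \<open>\<chi>\<close> vanishes on derivatives and
  \<open>\<delta>\<^sup>2 = 0\<close>. In the value of a word, all letters but the first therefore contribute only the scalar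
  \<open>\<chi>\<close> of the constant term of their exponent, and of the exponent of the first letter only the two
  lowest coefficients matter.

  The four generators express exactly this. Modulo them, in an arbitrary algebra with derivation,
  every word is a combination of two normal forms, \<open>x\<^sub>i x\<^sub>j x\<^sub>k \<dots>\<close> and \<open>x\<^sub>i\<^sup>\<delta> x\<^sub>j x\<^sub>k \<dots>\<close>
  (\<open>word_val_normal_form\<close>); in the first the letters after \<open>x\<^sub>i\<close> may be permuted freely
  (\<open>foldl_mul_perm\<close>), in the second all the letters may be (\<open>foldl_mul_der_perm\<close>). If \<open>x\<^sub>i\<close> takes the
  value \<open>t\<^sub>i e\<^sub>2\<^sub>2 + s\<^sub>i e\<^sub>1\<^sub>2\<close> in \<open>M\<^sub>1\<close>, the \<open>e\<^sub>1\<^sub>2\<close>-coordinates of the two forms are the monomials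
  \<open>s\<^sub>i t\<^sub>j t\<^sub>k \<dots>\<close> and \<open>t\<^sub>i t\<^sub>j t\<^sub>k \<dots>\<close>. Distinct monomials are linearly independent functions over a
  field of characteristic zero (\<open>monomial_functions_independent\<close>), so the coefficients of the
  normal form of an identity of \<open>M\<^sub>1\<close> are all zero, and the identity is a consequence of the
  generators (\<open>M1_identity_in_ideal\<close>).

  In the multilinear case of degree n there are n normal forms of the first kind and one of the
  second. The symmetric group permutes the former like the n letters and fixes the latter, so the
  cocharacter at a permutation is one plus its number of fixed points (\<open>codim_cochar_M1\<close>). On the
  other side, the character of \<open>(n)\<close> is constantly one (\<open>irr_char_trivial\<close>), and the left ideal of
  the Young symmetrizer of \<open>(n - 1, 1)\<close> is spanned by n vectors that are permuted like the letters
  and whose only relation is that their sum vanishes, so its character is the number of fixed points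
  minus one (\<open>irr_char_standard\<close>).

  The transposition of matrices across the antidiagonal is an anti-isomorphism between \<open>M\<^sub>2\<close> and
  \<open>M\<^sub>1\<close> that commutes with the derivations. Hence the identities of \<open>M\<^sub>2\<close> are those of \<open>M\<^sub>1\<close> with all
  words reversed (\<open>diff_Id_M2_iff\<close>), and everything carries over.
\<close>

section \<open>Dimension and trace on a quotient space\<close>

locale char_0_vector_space = vector_space scale
  for scale :: "'f::field_char_0 \<Rightarrow> 'v::ab_group_add \<Rightarrow> 'v"
begin

lemma sum_in_subspace:
  assumes "subspace U" "\<And>i. i \<in> S \<Longrightarrow> g i \<in> U"
  shows "(\<Sum>i\<in>S. scale (c i) (g i)) \<in> U"
  using assms by (intro subspace_sum subspace_scale)

lemma quot_coord_eqI:
  assumes W: "subspace W" and vs: "quot_basis scale V W vs"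
    and c: "v - (\<Sum>i<length vs. scale (c i) (vs ! i)) \<in> W" and i: "i < length vs"
  shows "quot_coord scale W vs v i = c i"
proof -
  let ?d = "quot_coord scale W vs v"
  have d: "v - (\<Sum>i<length vs. scale (?d i) (vs ! i)) \<in> W"
    unfolding quot_coord_def
    by (rule someI[of "\<lambda>c. v - (\<Sum>i<length vs. scale (c i) (vs ! i)) \<in> W"]) (rule c)
  have "(\<Sum>i<length vs. scale (?d i - c i) (vs ! i)) \<in> W"
    using subspace_diff[OF W c d] by (simp add: scale_left_diff_distrib sum_subtractf)
  moreover have "\<forall>c. (\<Sum>i<length vs. scale (c i) (vs ! i)) \<in> W \<longrightarrow> (\<forall>i<length vs. c i = 0)"
    using vs unfolding quot_basis_def by blast
  ultimately have "?d i - c i = 0" using i by (elim allE[of _ "\<lambda>i. ?d i - c i"]) simp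
  then show ?thesis by simp
qed

lemma quot_coord_spec:
  assumes "quot_basis scale V W vs" "v \<in> V"
  shows "v - (\<Sum>i<length vs. scale (quot_coord scale W vs v i) (vs ! i)) \<in> W"
proof -
  from assms have "\<exists>c. v - (\<Sum>i<length vs. scale (c i) (vs ! i)) \<in> W"
    unfolding quot_basis_def by blast
  then show ?thesis unfolding quot_coord_def by (rule someI_ex)
qed

lemma quot_coord_congruent:
  assumes W: "subspace W" and vs: "quot_basis scale V W vs" and v: "v \<in> V"
    and uv: "u - v \<in> W" and i: "i < length vs"
  shows "quot_coord scale W vs u i = quot_coord scale W vs v i"
  using W vs _ i
proof (rule quot_coord_eqI)
  show "u - (\<Sum>i<length vs. scale (quot_coord scale W vs v i) (vs ! i)) \<in> W"
    using subspace_add[OF W uv quot_coord_spec[OF vs v]] by simp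
qed

lemma quot_coord_sum:
  assumes W: "subspace W" and vs: "quot_basis scale V W vs"
    and g: "\<And>j. j \<in> S \<Longrightarrow> g j \<in> V" and i: "i < length vs"
  shows "quot_coord scale W vs (\<Sum>j\<in>S. scale (c j) (g j)) i
    = (\<Sum>j\<in>S. c j * quot_coord scale W vs (g j) i)"
  using W vs _ i
proof (rule quot_coord_eqI)
  have "(\<Sum>j\<in>S. scale (c j) (g j - (\<Sum>i<length vs. scale (quot_coord scale W vs (g j) i) (vs ! i)))) \<in> W"
    by (intro sum_in_subspace W quot_coord_spec[OF vs g])
  also have "(\<Sum>j\<in>S. scale (c j) (g j - (\<Sum>i<length vs. scale (quot_coord scale W vs (g j) i) (vs ! i))))
     = (\<Sum>j\<in>S. scale (c j) (g j))
      - (\<Sum>i<length vs. scale (\<Sum>j\<in>S. c j * quot_coord scale W vs (g j) i) (vs ! i))"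
    by (simp add: scale_right_diff_distrib sum_subtractf scale_sum_right scale_sum_left
        sum.swap[of _ S "{..<length vs}"])
  finally show "(\<Sum>j\<in>S. scale (c j) (g j))
      - (\<Sum>i<length vs. scale (\<Sum>j\<in>S. c j * quot_coord scale W vs (g j) i) (vs ! i)) \<in> W" .
qed

text \<open>
  Expanding each basis in the other one turns both traces into the same double sum; this is
  \<open>tr (P Q) = tr (Q P)\<close> for the two base changes, and it applies to bases whose lengths are not yet
  known to agree.
\<close>

lemma trace_basis_independent:
  assumes W: "subspace W" and T: "Vector_Spaces.linear scale scale T"
    and TV: "\<And>v. v \<in> V \<Longrightarrow> T v \<in> V" and TW: "\<And>w. w \<in> W \<Longrightarrow> T w \<in> W"
    and V: "subspace V"
    and us: "quot_basis scale V W us" and vs: "quot_basis scale V W vs"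
  shows "(\<Sum>i<length us. quot_coord scale W us (T (us ! i)) i)
       = (\<Sum>j<length vs. quot_coord scale W vs (T (vs ! j)) j)"
proof -
  interpret T: Vector_Spaces.linear scale scale T by fact
  let ?cu = "quot_coord scale W us" and ?cv = "quot_coord scale W vs"
  have uV: "us ! i \<in> V" if "i < length us" for i
    using us that unfolding quot_basis_def by (meson nth_mem subsetD)
  have vV: "vs ! i \<in> V" if "i < length vs" for i
    using vs that unfolding quot_basis_def by (meson nth_mem subsetD)
  have A: "?cv (T (vs ! j)) j = (\<Sum>i<length us. ?cu (vs ! j) i * ?cv (T (us ! i)) j)"
    if j: "j < length vs" for j
  proof -
    have "T (vs ! j - (\<Sum>i<length us. scale (?cu (vs ! j) i) (us ! i))) \<in> W"
      using quot_coord_spec[OF us vV[OF j]] by (rule TW)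
    then have "T (vs ! j) - (\<Sum>i<length us. scale (?cu (vs ! j) i) (T (us ! i))) \<in> W"
      by (simp add: T.diff T.sum T.scale)
    then have "?cv (T (vs ! j)) j = ?cv (\<Sum>i<length us. scale (?cu (vs ! j) i) (T (us ! i))) j"
      by (intro quot_coord_congruent[OF W vs _ _ j] sum_in_subspace V TV uV) auto
    then show ?thesis
      using quot_coord_sum[OF W vs _ j, of "{..<length us}" "\<lambda>i. T (us ! i)"] TV uV by simp
  qed
  have B: "?cu (T (us ! i)) i = (\<Sum>j<length vs. ?cu (vs ! j) i * ?cv (T (us ! i)) j)"
    if i: "i < length us" for i
  proof -
    have "?cu (T (us ! i)) i = ?cu (\<Sum>j<length vs. scale (?cv (T (us ! i)) j) (vs ! j)) i"
      by (intro quot_coord_congruent[OF W us _ _ i] sum_in_subspace V vV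
          quot_coord_spec[OF vs TV[OF uV[OF i]]]) auto
    then show ?thesis
      using quot_coord_sum[OF W us _ i, of "{..<length vs}" "\<lambda>j. vs ! j"] vV
      by (simp add: mult.commute)
  qed
  show ?thesis
    by (simp add: A B sum.swap[of _ "{..<length us}"])
qed

end

text \<open>
  The functionals \<open>l i\<close> vanish on W, so they are functions on V/W, and there they are the coordinates
  with respect to the cosets of the \<open>v i\<close>. That dimension and trace do not depend on the chosen basis
  makes the definite and indefinite choices in their definitions harmless.
\<close>

lemma quot_dim_trace:
  fixes s :: "'f::field_char_0 \<Rightarrow> 'v::ab_group_add \<Rightarrow> 'v"
  assumes s: "vector_space s" and V: "module.subspace s V" and W: "module.subspace s W"
    and v: "\<And>i. i < m \<Longrightarrow> v i \<in> V"
    and l: "\<And>i. i < m \<Longrightarrow> Vector_Spaces.linear s (*) (l i)"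
    and dual: "\<And>i j. \<lbrakk>i < m; j < m\<rbrakk> \<Longrightarrow> l i (v j) = (if i = j then 1 else 0)"
    and lW: "\<And>i w. \<lbrakk>i < m; w \<in> W\<rbrakk> \<Longrightarrow> l i w = 0"
    and gen: "\<And>u. u \<in> V \<Longrightarrow> u - (\<Sum>i<m. s (l i u) (v i)) \<in> W"
    and T: "Vector_Spaces.linear s s T"
    and TV: "\<And>u. u \<in> V \<Longrightarrow> T u \<in> V" and TW: "\<And>u. u \<in> W \<Longrightarrow> T u \<in> W"
  shows "quot_dim s V W = m" and "quot_trace s V W T = (\<Sum>i<m. l i (T (v i)))"
proof -
  interpret char_0_vector_space s using s by (rule char_0_vector_space.intro)
  let ?vs = "map v [0..<m]"
  have lsum: "l i (\<Sum>j<m. s (c j) (v j)) = c i" if "i < m" for c i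
  proof -
    interpret l: Vector_Spaces.linear s "(*)" "l i" using l[OF that] .
    show ?thesis using that by (simp add: l.sum l.scale dual if_distrib cong: if_cong)
  qed
  have basis: "quot_basis s V W ?vs"
    unfolding quot_basis_def
  proof (intro conjI ballI allI impI)
    fix u assume "u \<in> V"
    then show "\<exists>c. u - (\<Sum>i<length ?vs. s (c i) (?vs ! i)) \<in> W"
      by (intro exI[of _ "\<lambda>i. l i u"]) (simp add: gen)
  next
    fix c i assume "(\<Sum>i<length ?vs. s (c i) (?vs ! i)) \<in> W" and i: "i < length ?vs"
    then have "l i (\<Sum>j<m. s (c j) (v j)) = 0" by (intro lW) auto
    with i show "c i = 0" by (simp add: lsum)
  qed (auto simp: v)
  have coord: "quot_coord s W ?vs u i = l i u" if "u \<in> V" "i < m" for u i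
    by (rule quot_coord_eqI[OF W basis]) (use that gen in auto)
  have trace: "(\<Sum>i<length us. quot_coord s W us (S (us ! i)) i) = (\<Sum>i<m. l i (S (v i)))"
    if us: "quot_basis s V W us" and S: "Vector_Spaces.linear s s S"
      "\<And>u. u \<in> V \<Longrightarrow> S u \<in> V" "\<And>u. u \<in> W \<Longrightarrow> S u \<in> W" for us S
    using trace_basis_independent[OF W S V us basis] by (simp add: coord S(2) v)
  have dim: "length us = m" if us: "quot_basis s V W us" for us
  proof -
    have "us ! i \<in> V" if "i < length us" for i
      using us that unfolding quot_basis_def by (meson nth_mem subsetD)
    \<comment> \<open>The trace of the identity counts basis vectors, and the characteristic is zero.\<close>
    then have "(\<Sum>i<length us. quot_coord s W us (us ! i) i) = (\<Sum>i<m. l i (v i))"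
      using trace[OF us linear_id[unfolded id_def]] by simp
    moreover have "quot_coord s W us (us ! i) i = 1" if "i < length us" for i
    proof -
      have "(\<Sum>j<length us. s (if j = i then 1 else 0) (us ! j)) = us ! i"
        using that by (simp add: if_distrib[of "\<lambda>c. s c _"] cong: if_cong)
      then have "us ! i - (\<Sum>j<length us. s (if j = i then 1 else 0) (us ! j)) \<in> W"
        using subspace_0[OF W] by simp
      from quot_coord_eqI[OF W us this that] show ?thesis by simp
    qed
    ultimately have "of_nat (length us) = (of_nat m :: 'f)"
      by (simp add: dual)
    then show ?thesis by (simp only: of_nat_eq_iff)
  qed
  show "quot_dim s V W = m"
    unfolding quot_dim_def
  proof (rule the_equality)
    show "\<exists>vs. quot_basis s V W vs \<and> length vs = m"
      using basis by (intro exI[of _ ?vs]) auto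
  qed (use dim in auto)
  have "quot_basis s V W (SOME us. quot_basis s V W us)" using basis by (rule someI)
  from trace[OF this T TV TW] show "quot_trace s V W T = (\<Sum>i<m. l i (T (v i)))"
    unfolding quot_trace_def Let_def by simp
qed

section \<open>Linear combinations of basis elements\<close>

lemma lookup_pm_scale [simp]: "Poly_Mapping.lookup (pm_scale c p) w = c * Poly_Mapping.lookup p w"
  by (simp add: pm_scale_def Poly_Mapping.map.rep_eq when_def)

lemma keys_pm_scale: "Poly_Mapping.keys (pm_scale c p) \<subseteq> Poly_Mapping.keys p"
  by (auto simp: in_keys_iff)

interpretation pm: vector_space pm_scale
  by unfold_locales (auto intro!: poly_mapping_eqI simp: lookup_add algebra_simps)

interpretation mt: vector_space mat_scale
  by (rule vector_space_mat_scale)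

interpretation pl: vector_space "smult :: 'f::field_char_0 \<Rightarrow> 'f poly \<Rightarrow> 'f poly"
  by unfold_locales (auto simp: smult_add_right smult_add_left)

lemma pm_scale_single [simp]: "pm_scale c (Poly_Mapping.single w d) = Poly_Mapping.single w (c * d)"
  by (rule poly_mapping_eqI) (simp add: lookup_single when_def)

text \<open>
  To check a property that is stable under sums on all combinations of basis elements from S, it is
  enough to check it on multiples of single basis elements. The supports are kept in the addition
  step because substitution is multiplicative only on polynomials without constant term.
\<close>

lemma keys_induct [consumes 1, case_names zero single add]:
  fixes p :: "'k \<Rightarrow>\<^sub>0 'f::comm_monoid_add"
  assumes p: "Poly_Mapping.keys p \<subseteq> S"
    and zero: "P 0"
    and single: "\<And>k c. k \<in> S \<Longrightarrow> P (Poly_Mapping.single k c)"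
    and add: "\<And>p q. \<lbrakk>Poly_Mapping.keys p \<subseteq> S; Poly_Mapping.keys q \<subseteq> S; P p; P q\<rbrakk> \<Longrightarrow> P (p + q)"
  shows "P p"
proof -
  define g where "g T = (\<Sum>k\<in>T. Poly_Mapping.single k (Poly_Mapping.lookup p k))" for T
  have "Poly_Mapping.keys (g T) \<subseteq> S \<and> P (g T)" if "finite T" "T \<subseteq> S" for T
    using that
  proof (induction T rule: finite_induct)
    case empty
    then show ?case by (simp add: g_def zero)
  next
    case (insert k T)
    then have "g (insert k T) = Poly_Mapping.single k (Poly_Mapping.lookup p k) + g T"
      by (simp add: g_def)
    with insert show ?case
      using keys_add[of "Poly_Mapping.single k (Poly_Mapping.lookup p k)" "g T"]
      by (auto intro!: add single split: if_splits)
  qed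
  moreover have "g (Poly_Mapping.keys p) = p"
    by (rule poly_mapping_eqI)
      (auto simp: g_def lookup_sum lookup_single when_def in_keys_iff if_distrib cong: if_cong)
  ultimately show ?thesis using p by (metis finite_keys)
qed

lemma pm_scale_mult_left: "pm_scale c p * q = pm_scale c (p * q)"
  for p q :: "'k::monoid_add \<Rightarrow>\<^sub>0 'f::field_char_0"
  by (simp add: pm_scale_def mult_map_scale_conv_mult mult.assoc)

lemma pm_scale_mult_right: "p * pm_scale c q = pm_scale c (p * q)"
  for p q :: "'k::monoid_add \<Rightarrow>\<^sub>0 'f::field_char_0"
proof -
  have "p * Poly_Mapping.single 0 c = Poly_Mapping.single 0 c * p"
    using subset_UNIV
    by (induction p rule: keys_induct) (simp_all add: mult_single distrib_left distrib_right mult.commute)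
  then show ?thesis
    by (simp add: pm_scale_def mult_map_scale_conv_mult mult.assoc flip: mult.assoc[of p])
qed

context char_0_vector_space
begin

lemma lin_ext_superset:
  assumes "finite S" "Poly_Mapping.keys p \<subseteq> S"
  shows "lin_ext scale g p = (\<Sum>w\<in>S. scale (Poly_Mapping.lookup p w) (g w))"
  unfolding lin_ext_def using assms by (intro sum.mono_neutral_left) (auto simp: in_keys_iff)

lemma linear_lin_ext: "Vector_Spaces.linear pm_scale scale (lin_ext scale g)"
proof -
  have add: "lin_ext scale g (p + q) = lin_ext scale g p + lin_ext scale g q" for p q
    using keys_add[of p q]
    by (simp add: lin_ext_superset[of "Poly_Mapping.keys p \<union> Poly_Mapping.keys q"]
        lookup_add scale_left_distrib sum.distrib)
  have "lin_ext scale g (pm_scale c p) = scale c (lin_ext scale g p)" for c p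
    by (simp add: lin_ext_superset[of "Poly_Mapping.keys p"] keys_pm_scale scale_sum_right)
  with add show ?thesis
    by unfold_locales (simp_all add: scale_right_distrib scale_left_distrib)
qed

lemma
  shows lin_ext_0 [simp]: "lin_ext scale g 0 = 0"
    and lin_ext_add: "lin_ext scale g (p + q) = lin_ext scale g p + lin_ext scale g q"
    and lin_ext_diff: "lin_ext scale g (p - q) = lin_ext scale g p - lin_ext scale g q"
    and lin_ext_scale: "lin_ext scale g (pm_scale c p) = scale c (lin_ext scale g p)"
    and lin_ext_sum: "lin_ext scale g (\<Sum>i\<in>S. r i) = (\<Sum>i\<in>S. lin_ext scale g (r i))"
proof -
  interpret l: Vector_Spaces.linear pm_scale scale "lin_ext scale g" by (rule linear_lin_ext)
  show "lin_ext scale g 0 = 0" by (rule l.zero)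
  show "lin_ext scale g (p + q) = lin_ext scale g p + lin_ext scale g q" by (rule l.add)
  show "lin_ext scale g (p - q) = lin_ext scale g p - lin_ext scale g q" by (rule l.diff)
  show "lin_ext scale g (pm_scale c p) = scale c (lin_ext scale g p)" by (rule l.scale)
  show "lin_ext scale g (\<Sum>i\<in>S. r i) = (\<Sum>i\<in>S. lin_ext scale g (r i))" by (rule l.sum)
qed

lemma lin_ext_single [simp]: "lin_ext scale g (Poly_Mapping.single w c) = scale c (g w)"
  by (simp add: lin_ext_def)

lemma lin_ext_in_subspace:
  assumes "subspace U" "\<And>w. w \<in> Poly_Mapping.keys p \<Longrightarrow> g w \<in> U"
  shows "lin_ext scale g p \<in> U"
  unfolding lin_ext_def using assms by (rule sum_in_subspace)

end

interpretation pm: char_0_vector_space pm_scale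
  by (rule char_0_vector_space.intro) (rule pm.vector_space_axioms)

interpretation mt: char_0_vector_space mat_scale
  by (rule char_0_vector_space.intro) (rule vector_space_mat_scale)

section \<open>Algebras with a derivation and their homomorphisms\<close>

lemma nprod_Cons: "xs \<noteq> [] \<Longrightarrow> nprod m (a # xs) = m a (nprod m xs)"
  by (cases xs) auto

context L_algebra
begin

sublocale vs: char_0_vector_space "scl A"
  by (rule char_0_vector_space.intro) (rule scl_vector_space)

lemma zero_closed [simp]: "0 \<in> carr A"
  by (rule vs.subspace_0[OF carr_subspace])

lemma add_closed: "\<lbrakk>a \<in> carr A; b \<in> carr A\<rbrakk> \<Longrightarrow> a + b \<in> carr A"
  by (rule vs.subspace_add[OF carr_subspace])

lemma diff_closed: "\<lbrakk>a \<in> carr A; b \<in> carr A\<rbrakk> \<Longrightarrow> a - b \<in> carr A"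
  by (rule vs.subspace_diff[OF carr_subspace])

lemma scl_closed: "a \<in> carr A \<Longrightarrow> scl A c a \<in> carr A"
  by (rule vs.subspace_scale[OF carr_subspace])

lemma mul_zero_left [simp]: "b \<in> carr A \<Longrightarrow> mul A 0 b = 0"
  using mul_add_left[of 0 0 b] by simp

lemma mul_zero_right [simp]: "a \<in> carr A \<Longrightarrow> mul A a 0 = 0"
  using mul_add_right[of a 0 0] by simp

lemma der_zero [simp]: "der A 0 = 0"
  using der_add[of 0 0] by simp

lemma mul_diff_left:
  "\<lbrakk>a \<in> carr A; b \<in> carr A; c \<in> carr A\<rbrakk> \<Longrightarrow> mul A (a - b) c = mul A a c - mul A b c"
  using mul_add_left[of "a - b" b c] by (simp add: diff_closed)

lemma mul_diff_right:
  "\<lbrakk>a \<in> carr A; b \<in> carr A; c \<in> carr A\<rbrakk> \<Longrightarrow> mul A a (b - c) = mul A a b - mul A a c"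
  using mul_add_right[of a "b - c" c] by (simp add: diff_closed)

lemma der_sum:
  "(\<And>i. i \<in> S \<Longrightarrow> g i \<in> carr A) \<Longrightarrow>
    (\<Sum>i\<in>S. g i) \<in> carr A \<and> der A (\<Sum>i\<in>S. g i) = (\<Sum>i\<in>S. der A (g i))"
  by (induction S rule: infinite_finite_induct) (auto simp: add_closed der_add)

lemma der_power_closed: "a \<in> carr A \<Longrightarrow> (der A ^^ k) a \<in> carr A"
  by (induction k) (simp_all add: der_closed)

lemma U_act_superset:
  "degree h \<le> n \<Longrightarrow> U_act A h a = (\<Sum>k\<le>n. scl A (coeff h k) ((der A ^^ k) a))"
  unfolding U_act_def by (intro sum.mono_neutral_left) (auto simp: coeff_eq_0)

lemma U_act_closed: "a \<in> carr A \<Longrightarrow> U_act A h a \<in> carr A"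
  unfolding U_act_def by (intro vs.subspace_sum carr_subspace scl_closed der_power_closed)

lemma U_act_zero [simp]: "U_act A 0 a = 0"
  by (simp add: U_act_def)

lemma U_act_add: "U_act A (h + k) a = U_act A h a + U_act A k a"
  by (simp add: U_act_superset[of _ "max (degree h) (degree k)"] degree_add_le_max
      vs.scale_left_distrib sum.distrib)

lemma U_act_smult: "U_act A (smult c h) a = scl A c (U_act A h a)"
  by (simp add: U_act_superset[of _ "degree h"] vs.scale_sum_right)

lemma U_act_sum: "U_act A (\<Sum>i\<in>S. h i) a = (\<Sum>i\<in>S. U_act A (h i) a)"
  by (induction S rule: infinite_finite_induct) (auto simp: U_act_add)

text \<open>
  The exponent \<open>c + \<delta> h\<close> acts as \<open>c + \<delta> \<circ> h\<close>. This recursion lets facts about the action be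
  proved by induction over the coefficients of the exponent.
\<close>

lemma U_act_pCons:
  assumes "a \<in> carr A"
  shows "U_act A (pCons c h) a = scl A c a + der A (U_act A h a)"
proof -
  have "der A (U_act A h a) = (\<Sum>k\<le>degree h. scl A (coeff h k) ((der A ^^ Suc k) a))"
    unfolding U_act_def using der_sum[of "{..degree h}"]
    by (simp add: assms scl_closed der_power_closed der_scl)
  moreover have "U_act A (pCons c h) a
      = scl A c a + (\<Sum>k\<le>degree h. scl A (coeff h k) ((der A ^^ Suc k) a))"
    by (subst U_act_superset[of _ "Suc (degree h)"])
      (simp_all add: degree_pCons_le sum.atMost_Suc_shift del: sum.atMost_Suc funpow.simps(2))
  ultimately show ?thesis by simp
qed

lemma U_act_one: "a \<in> carr A \<Longrightarrow> U_act A 1 a = a"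
  by (simp add: one_pCons U_act_pCons)

lemma U_act_delta: "a \<in> carr A \<Longrightarrow> U_act A delta a = der A a"
  by (simp add: U_act_pCons)

lemma U_act_delta_times: "a \<in> carr A \<Longrightarrow> U_act A (delta * h) a = der A (U_act A h a)"
  by (simp add: U_act_pCons)

lemma U_act_in_subspace:
  assumes "module.subspace (scl A) U" "\<And>a. a \<in> U \<Longrightarrow> der A a \<in> U" "a \<in> U"
  shows "U_act A h a \<in> U"
proof -
  have "(der A ^^ k) a \<in> U" for k
    by (induction k) (simp_all add: assms)
  then show ?thesis
    unfolding U_act_def by (intro vs.subspace_sum vs.subspace_scale assms(1))
qed

lemma nprod_closed: "set xs \<subseteq> carr A \<Longrightarrow> nprod (mul A) xs \<in> carr A"
  by (induction "mul A" xs rule: nprod.induct) (auto simp: mul_closed)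

lemma nprod_append:
  "\<lbrakk>xs \<noteq> []; ys \<noteq> []; set xs \<subseteq> carr A; set ys \<subseteq> carr A\<rbrakk> \<Longrightarrow>
    nprod (mul A) (xs @ ys) = mul A (nprod (mul A) xs) (nprod (mul A) ys)"
proof (induction xs)
  case (Cons a xs)
  then show ?case
    by (cases "xs = []") (auto simp: nprod_Cons mul_assoc nprod_closed)
qed simp

end

definition word_val ::
  "('f::field_char_0, 'a::ab_group_add) L_alg \<Rightarrow> (nat \<Rightarrow> 'a) \<Rightarrow> (nat \<times> 'f poly) list \<Rightarrow> 'a" where
  "word_val A \<phi> xs = nprod (mul A) (map (\<lambda>(j, h). U_act A h (\<phi> j)) xs)"

lemma diff_subst_word_val:
  "diff_subst A \<phi> = lin_ext (scl A) (\<lambda>w. word_val A \<phi> (letters w))"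
  by (simp add: diff_subst_def word_val_def fun_eq_iff)

context L_algebra
begin

lemma word_val_closed: "\<forall>j. \<phi> j \<in> carr A \<Longrightarrow> word_val A \<phi> xs \<in> carr A"
  unfolding word_val_def by (intro nprod_closed) (auto simp: U_act_closed)

lemma word_val_single [simp]: "word_val A \<phi> [(j, h)] = U_act A h (\<phi> j)"
  by (simp add: word_val_def)

lemma word_val_append:
  "\<lbrakk>\<forall>j. \<phi> j \<in> carr A; xs \<noteq> []; ys \<noteq> []\<rbrakk> \<Longrightarrow>
    word_val A \<phi> (xs @ ys) = mul A (word_val A \<phi> xs) (word_val A \<phi> ys)"
  unfolding word_val_def by (auto simp: U_act_closed intro!: nprod_append)

lemma diff_subst_single [simp]:
  "diff_subst A \<phi> (Poly_Mapping.single (NCWord xs) c) = scl A c (word_val A \<phi> xs)"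
  by (simp add: diff_subst_word_val)

lemma
  shows diff_subst_0 [simp]: "diff_subst A \<phi> 0 = 0"
    and diff_subst_add: "diff_subst A \<phi> (p + q) = diff_subst A \<phi> p + diff_subst A \<phi> q"
    and diff_subst_diff: "diff_subst A \<phi> (p - q) = diff_subst A \<phi> p - diff_subst A \<phi> q"
    and diff_subst_scale: "diff_subst A \<phi> (pm_scale c p) = scl A c (diff_subst A \<phi> p)"
    and diff_subst_sum: "diff_subst A \<phi> (\<Sum>i\<in>S. r i) = (\<Sum>i\<in>S. diff_subst A \<phi> (r i))"
  by (simp_all add: diff_subst_word_val vs.lin_ext_add vs.lin_ext_diff vs.lin_ext_scale
      vs.lin_ext_sum)

lemma diff_subst_closed: "\<forall>j. \<phi> j \<in> carr A \<Longrightarrow> diff_subst A \<phi> f \<in> carr A"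
  unfolding diff_subst_word_val
  by (intro vs.lin_ext_in_subspace carr_subspace word_val_closed)

end

text \<open>
  Substitutions into an algebra, the composition of two substitutions and the passage between
  \<open>M\<^sub>2\<close> and the opposite of \<open>M\<^sub>1\<close> are all governed by one fact: homomorphisms commute with
  substitutions (\<open>hom_diff_subst\<close> below).
\<close>

locale L_hom = S: L_algebra A + T: L_algebra A'
  for A :: "('f::field_char_0, 'a::ab_group_add) L_alg"
    and A' :: "('f, 'b::ab_group_add) L_alg" +
  fixes \<theta> :: "'a \<Rightarrow> 'b"
  assumes hom_closed: "a \<in> carr A \<Longrightarrow> \<theta> a \<in> carr A'"
    and hom_add: "\<lbrakk>a \<in> carr A; b \<in> carr A\<rbrakk> \<Longrightarrow> \<theta> (a + b) = \<theta> a + \<theta> b"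
    and hom_scl: "a \<in> carr A \<Longrightarrow> \<theta> (scl A c a) = scl A' c (\<theta> a)"
    and hom_mul: "\<lbrakk>a \<in> carr A; b \<in> carr A\<rbrakk> \<Longrightarrow> \<theta> (mul A a b) = mul A' (\<theta> a) (\<theta> b)"
    and hom_der: "a \<in> carr A \<Longrightarrow> \<theta> (der A a) = der A' (\<theta> a)"
begin

lemma hom_0 [simp]: "\<theta> 0 = 0"
  using hom_add[of 0 0] by simp

lemma hom_U_act: "a \<in> carr A \<Longrightarrow> \<theta> (U_act A h a) = U_act A' h (\<theta> a)"
  by (induction h)
    (simp_all add: S.U_act_pCons T.U_act_pCons hom_add hom_scl hom_der hom_closed
      S.scl_closed S.der_closed S.U_act_closed)

lemma hom_nprod: "set xs \<subseteq> carr A \<Longrightarrow> \<theta> (nprod (mul A) xs) = nprod (mul A') (map \<theta> xs)"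
proof (induction xs)
  case (Cons a xs)
  then show ?case
    by (cases xs) (simp_all add: hom_mul S.nprod_closed del: nprod.simps(3) add: nprod_Cons)
qed simp

lemma hom_word_val:
  assumes "\<forall>j. \<phi> j \<in> carr A"
  shows "\<theta> (word_val A \<phi> xs) = word_val A' (\<lambda>j. \<theta> (\<phi> j)) xs"
proof -
  have "set (map (\<lambda>(j, h). U_act A h (\<phi> j)) xs) \<subseteq> carr A"
    using assms by (auto simp: S.U_act_closed)
  from hom_nprod[OF this] show ?thesis
    using assms by (simp add: word_val_def o_def case_prod_unfold hom_U_act)
qed

lemma hom_diff_subst:
  assumes "\<forall>j. \<phi> j \<in> carr A"
  shows "\<theta> (diff_subst A \<phi> f) = diff_subst A' (\<lambda>j. \<theta> (\<phi> j)) f"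
proof -
  have "\<theta> (\<Sum>w\<in>K. scl A (c w) (word_val A \<phi> (letters w)))
      = (\<Sum>w\<in>K. scl A' (c w) (word_val A' (\<lambda>j. \<theta> (\<phi> j)) (letters w)))" for K c
    by (induction K rule: infinite_finite_induct)
      (simp_all add: hom_add hom_scl hom_word_val assms S.word_val_closed S.scl_closed
        S.vs.subspace_sum[OF S.carr_subspace])
  then show ?thesis by (simp add: diff_subst_word_val lin_ext_def)
qed

end

section \<open>The free differential algebra\<close>

abbreviation wd :: "(nat \<times> 'f::field_char_0 poly) list \<Rightarrow> 'f diff_poly" where
  "wd xs \<equiv> Poly_Mapping.single (NCWord xs) 1"

lemma wd_Nil: "wd [] = 1"
  by (simp flip: zero_nc_word_def)

lemma NCWord_add [simp]: "NCWord xs + NCWord ys = NCWord (xs @ ys)"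
  by (simp add: plus_nc_word_def)

definition admissible :: "'f::field_char_0 poly set \<Rightarrow> (nat \<times> 'f poly) nc_word set" where
  "admissible B = {w. letters w \<noteq> [] \<and> snd ` set (letters w) \<subseteq> B}"

lemma free_L_alg_simps:
  "f \<in> carr (free_L_alg B) \<longleftrightarrow> Poly_Mapping.keys f \<subseteq> admissible B"
  "scl (free_L_alg B) = pm_scale" "mul (free_L_alg B) = (*)"
  "der (free_L_alg B) = lin_ext pm_scale (word_der B)"
  by (auto simp: free_L_alg_def admissible_def)

lemma subspace_free_carr: "pm.subspace (carr (free_L_alg B))"
proof (rule pm.subspaceI)
  fix p q assume "p \<in> carr (free_L_alg B)" "q \<in> carr (free_L_alg B)"
  then show "p + q \<in> carr (free_L_alg B)"
    using keys_add[of p q] by (auto simp: free_L_alg_simps)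
next
  fix c and p :: "'a diff_poly" assume "p \<in> carr (free_L_alg B)"
  then show "pm_scale c p \<in> carr (free_L_alg B)"
    using keys_pm_scale[of c p] by (auto simp: free_L_alg_simps)
qed (simp add: free_L_alg_simps)

lemma free_mult_closed:
  assumes "p \<in> carr (free_L_alg B)" "q \<in> carr (free_L_alg B)"
  shows "p * q \<in> carr (free_L_alg B)"
proof -
  have "u + v \<in> admissible B" if "u \<in> admissible B" "v \<in> admissible B" for u v
    using that by (auto simp: admissible_def plus_nc_word_def)
  then show ?thesis
    using keys_mult[of p q] assms unfolding free_L_alg_simps by fast
qed

lemma wd_closed:
  "\<lbrakk>xs \<noteq> []; snd ` set xs \<subseteq> B\<rbrakk> \<Longrightarrow> Poly_Mapping.single (NCWord xs) c \<in> carr (free_L_alg B)"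
  by (simp add: free_L_alg_simps admissible_def)

lemma word_der_Nil [simp]: "word_der B (NCWord []) = 0"
  by (simp add: word_der_def)

text \<open>
  The closed formula for the derivative of a word is traded for a recursion over its letters; the
  Leibniz rule for products of words, and with it for all products, follows by induction.
\<close>

lemma word_der_Cons:
  "word_der B (NCWord (x # xs))
    = dvar B (fst x) (delta * snd x) * wd xs + wd [x] * word_der B (NCWord xs)"
proof -
  have [simp]: "wd [x] * (wd ys * p) = wd (x # ys) * p" for ys and p :: "'a diff_poly"
    by (simp add: mult_single flip: mult.assoc)
  show ?thesis
    unfolding word_der_def Let_def
    by (simp add: sum.lessThan_Suc_shift sum_distrib_left wd_Nil mult.assoc del: sum.lessThan_Suc)
qed

lemma word_der_append:
  "word_der B (NCWord (xs @ ys))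
    = word_der B (NCWord xs) * wd ys + wd xs * word_der B (NCWord ys)"
proof (induction xs)
  case Nil
  then show ?case by (simp add: wd_Nil)
next
  case (Cons x xs)
  have "wd (x # xs) = wd [x] * wd xs" by (simp add: mult_single)
  moreover have "wd (xs @ ys) = wd xs * wd ys" by (simp add: mult_single)
  ultimately show ?case
    by (simp add: word_der_Cons Cons algebra_simps)
qed

lemma free_der_mult:
  "lin_ext pm_scale (word_der B) (p * q)
    = lin_ext pm_scale (word_der B) p * q + p * lin_ext pm_scale (word_der B) q"
  (is "?D (p * q) = _")
  using subset_UNIV
proof (induction p rule: keys_induct)
  case (single u c)
  show ?case using subset_UNIV
  proof (induction q rule: keys_induct)
    case (single v d)
    obtain xs ys where uv: "u = NCWord xs" "v = NCWord ys"
      by (cases u; cases v)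
    have "Poly_Mapping.single u c = pm_scale c (wd xs)" "Poly_Mapping.single v d = pm_scale d (wd ys)"
      by (simp_all add: uv)
    moreover have "?D (wd xs * wd ys) = ?D (wd xs) * wd ys + wd xs * ?D (wd ys)"
      by (simp add: mult_single word_der_append)
    ultimately show ?case
      by (simp only: pm_scale_mult_left pm_scale_mult_right pm.lin_ext_scale
          pm.scale_right_distrib)
  qed (simp_all add: algebra_simps pm.lin_ext_add)
qed (simp_all add: algebra_simps pm.lin_ext_add)

context
  fixes B :: "'f::field_char_0 poly set"
  assumes B: "U_basis B"
begin

lemma span_U_basis: "h \<in> pl.span B"
  using B by (simp add: U_basis_def)

lemma dvar_superset:
  assumes "finite S" "{b. pl.representation B h b \<noteq> 0} \<subseteq> S"
  shows "dvar B j h = (\<Sum>b\<in>S. Poly_Mapping.single (NCWord [(j, b)]) (pl.representation B h b))"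
  unfolding dvar_def using assms by (intro sum.mono_neutral_left) auto

lemma dvar_basis: "b \<in> B \<Longrightarrow> dvar B j b = wd [(j, b)]"
  using B by (subst dvar_superset[of "{b}"]) (auto simp: U_basis_def pl.representation_basis)

lemma dvar_add: "dvar B j (h + k) = dvar B j h + dvar B j k"
proof -
  have *: "pl.representation B (h + k) b = pl.representation B h b + pl.representation B k b" for b
    using B pl.representation_add[OF _ span_U_basis span_U_basis] by (simp add: U_basis_def)
  show ?thesis
    by (subst (1 2 3) dvar_superset[of "{b. pl.representation B h b \<noteq> 0} \<union> {b. pl.representation B k b \<noteq> 0}"])
      (auto simp: pl.finite_representation * single_add sum.distrib)
qed

lemma dvar_smult: "dvar B j (smult c h) = pm_scale c (dvar B j h)"
proof -
  have *: "pl.representation B (smult c h) b = c * pl.representation B h b" for b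
    using B pl.representation_scale[OF _ span_U_basis] by (simp add: U_basis_def)
  show ?thesis
    by (subst (1 2) dvar_superset[of "{b. pl.representation B h b \<noteq> 0}"])
      (auto simp: pl.finite_representation * pm.scale_sum_right)
qed

lemma dvar_closed: "dvar B j h \<in> carr (free_L_alg B)"
  unfolding dvar_def
  by (intro pm.subspace_sum subspace_free_carr wd_closed) (auto dest: pl.representation_ne_zero)

lemma word_der_closed: "w \<in> admissible B \<Longrightarrow> word_der B w \<in> carr (free_L_alg B)"
proof -
  have "snd ` set xs \<subseteq> B \<Longrightarrow> word_der B (NCWord xs) \<in> carr (free_L_alg B)" for xs
  proof (induction xs)
    case (Cons x xs)
    moreover have "dvar B (fst x) (delta * snd x) * wd xs \<in> carr (free_L_alg B)"
      using Cons by (cases "xs = []") (auto simp only: wd_Nil mult_1_right intro!: dvar_closed free_mult_closed wd_closed, auto)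
    ultimately show ?case
      by (auto simp: word_der_Cons intro!: pm.subspace_add subspace_free_carr free_mult_closed wd_closed)
  qed (simp add: free_L_alg_simps)
  then show "w \<in> admissible B \<Longrightarrow> word_der B w \<in> carr (free_L_alg B)"
    by (cases w) (simp add: admissible_def)
qed

lemma L_algebra_free: "L_algebra (free_L_alg B)"
proof
  show "der (free_L_alg B) a \<in> carr (free_L_alg B)" if "a \<in> carr (free_L_alg B)" for a
    using that word_der_closed unfolding free_L_alg_simps(4)
    by (intro pm.lin_ext_in_subspace subspace_free_carr) (auto simp: free_L_alg_simps)
qed (auto simp: free_L_alg_simps(2-4) algebra_simps subspace_free_carr free_mult_closed
    pm_scale_mult_left pm_scale_mult_right pm.lin_ext_add pm.lin_ext_scale free_der_mult
    pm.vector_space_axioms)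

text \<open>
  The letter with exponent h is a combination of letters with exponents in B; since the action is
  linear in the exponent, the choice of B drops out.
\<close>

lemma diff_subst_dvar:
  assumes "L_algebra A"
  shows "diff_subst A \<phi> (dvar B j h) = U_act A h (\<phi> j)"
proof -
  interpret L_algebra A by fact
  let ?r = "pl.representation B h"
  have "diff_subst A \<phi> (dvar B j h) = U_act A (\<Sum>b | ?r b \<noteq> 0. smult (?r b) b) (\<phi> j)"
    by (simp add: dvar_def diff_subst_sum U_act_sum U_act_smult)
  also have "(\<Sum>b | ?r b \<noteq> 0. smult (?r b) b) = h"
    using B span_U_basis by (intro pl.sum_nonzero_representation_eq) (auto simp: U_basis_def)
  finally show ?thesis .
qed

lemma diff_subst_mult:
  assumes "L_algebra A" and \<phi>: "\<forall>j. \<phi> j \<in> carr A"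
    and pq: "p \<in> carr (free_L_alg B)" "q \<in> carr (free_L_alg B)"
  shows "diff_subst A \<phi> (p * q) = mul A (diff_subst A \<phi> p) (diff_subst A \<phi> q)"
proof -
  interpret L_algebra A by fact
  note closed = diff_subst_closed[OF \<phi>] word_val_closed[OF \<phi>] scl_closed
  from pq(1) show ?thesis
    unfolding free_L_alg_simps
  proof (induction p rule: keys_induct)
    case (single u c)
    then obtain xs where u: "u = NCWord xs" and xs: "xs \<noteq> []"
      by (cases u) (auto simp: admissible_def)
    from pq(2) show ?case
      unfolding free_L_alg_simps
    proof (induction q rule: keys_induct)
      case (single v d)
      then obtain ys where v: "v = NCWord ys" and ys: "ys \<noteq> []"
        by (cases v) (auto simp: admissible_def)
      show ?case
        by (simp add: u v mult_single word_val_append \<phi> xs ys mul_scl_left mul_scl_right closed)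
    qed (simp_all add: u closed distrib_left diff_subst_add mul_add_right)
  qed (simp_all add: closed distrib_right diff_subst_add mul_add_left)
qed

lemma word_val_der:
  assumes A: "L_algebra A" and \<phi>: "\<forall>j. \<phi> j \<in> carr A" and xs: "xs \<noteq> []" "snd ` set xs \<subseteq> B"
  shows "diff_subst A \<phi> (word_der B (NCWord xs)) = der A (word_val A \<phi> xs)"
proof -
  interpret L_algebra A by fact
  from xs show ?thesis
  proof (induction xs)
    case (Cons x xs)
    have x: "diff_subst A \<phi> (dvar B (fst x) (pCons 0 (snd x))) = der A (word_val A \<phi> [x])"
      using \<phi> by (simp add: diff_subst_dvar A U_act_pCons case_prod_unfold word_val_def)
    show ?case
    proof (cases "xs = []")
      case True
      then show ?thesis using x by (simp add: word_der_Cons wd_Nil)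
    next
      case False
      have "word_der B (NCWord xs) \<in> carr (free_L_alg B)"
        using False Cons.prems by (intro word_der_closed) (simp add: admissible_def)
      with False Cons show ?thesis
        using der_mul[of "word_val A \<phi> [x]" "word_val A \<phi> xs"] word_val_append[OF \<phi>, of "[x]" xs]
        by (simp add: word_der_Cons diff_subst_add diff_subst_mult A \<phi> x dvar_closed wd_closed
            word_val_closed)
    qed
  qed simp
qed

text \<open>
  This is the existence half of the universal property of the free differential algebra.
\<close>

lemma L_hom_diff_subst:
  assumes A: "L_algebra A" and \<phi>: "\<forall>j. \<phi> j \<in> carr A"
  shows "L_hom (free_L_alg B) A (diff_subst A \<phi>)"
proof -
  interpret F: L_algebra "free_L_alg B" by (rule L_algebra_free)
  interpret L_algebra A by fact
  show ?thesis
  proof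
    fix f assume "f \<in> carr (free_L_alg B)"
    then show "diff_subst A \<phi> (der (free_L_alg B) f) = der A (diff_subst A \<phi> f)"
      unfolding free_L_alg_simps
    proof (induction f rule: keys_induct)
      case (single w c)
      then obtain xs where "w = NCWord xs" "xs \<noteq> []" "snd ` set xs \<subseteq> B"
        by (cases w) (auto simp: admissible_def)
      then show ?case
        by (simp add: diff_subst_scale word_val_der A \<phi> der_scl word_val_closed)
    qed (simp_all add: pm.lin_ext_add diff_subst_add der_add diff_subst_closed \<phi>)
  qed (auto simp: diff_subst_closed diff_subst_mult diff_subst_add diff_subst_scale A \<phi>
      free_L_alg_simps(2-3))
qed

lemma U_act_dvar: "U_act (free_L_alg B) h (dvar B j 1) = dvar B j h"
proof -
  interpret F: L_algebra "free_L_alg B" by (rule L_algebra_free)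
  have der: "der (free_L_alg B) (dvar B j k) = dvar B j (delta * k)" for k
  proof -
    have "dvar B j (delta * b) = word_der B (NCWord [(j, b)])" for b
      by (simp add: word_der_Cons wd_Nil)
    then have b: "lin_ext pm_scale (word_der B) (dvar B j b) = dvar B j (delta * b)" if "b \<in> B" for b
      using that by (simp add: dvar_basis)
    from span_U_basis[of k] show ?thesis
      unfolding free_L_alg_simps(4)
    proof (induction rule: pl.span_induct_alt)
      case base
      have "dvar B j 0 = 0" using dvar_smult[of j 0 0] by simp
      then show ?case by simp
    next
      case (step c b k)
      then show ?case
        by (simp only: dvar_add dvar_smult b pm.lin_ext_add pm.lin_ext_scale distrib_left mult_smult_right)
    qed
  qed
  show ?thesis
  proof (induction h)
    case 0
    then show ?case using dvar_smult[of j 0 0] by simp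
  next
    case (pCons c h)
    have "pCons c h = smult c 1 + delta * h" by (simp add: one_pCons)
    then have "dvar B j (pCons c h) = pm_scale c (dvar B j 1) + dvar B j (delta * h)"
      by (simp only: dvar_add dvar_smult)
    then show ?case
      by (simp only: F.U_act_pCons[OF dvar_closed] der free_L_alg_simps(2) pCons.IH)
  qed
qed

text \<open>
  Every differential polynomial is a value of itself. Statements about the values of a polynomial in
  arbitrary algebras thereby become statements about the polynomial.
\<close>

lemma diff_subst_id:
  assumes "f \<in> carr (free_L_alg B)"
  shows "diff_subst (free_L_alg B) (\<lambda>j. dvar B j 1) f = f"
proof -
  interpret F: L_algebra "free_L_alg B" by (rule L_algebra_free)
  have wv: "xs \<noteq> [] \<Longrightarrow> snd ` set xs \<subseteq> B \<Longrightarrow> word_val (free_L_alg B) (\<lambda>j. dvar B j 1) xs = wd xs" for xs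
  proof (induction xs)
    case (Cons x xs)
    then show ?case
      by (cases "xs = []"; cases x)
        (auto simp: word_val_def nprod_Cons U_act_dvar dvar_basis free_L_alg_simps(3) mult_single)
  qed simp
  from assms show ?thesis
    unfolding free_L_alg_simps
  proof (induction f rule: keys_induct)
    case (single w c)
    then obtain xs where "w = NCWord xs" "xs \<noteq> []" "snd ` set xs \<subseteq> B"
      by (cases w) (auto simp: admissible_def)
    then show ?case by (simp add: wv free_L_alg_simps(2))
  qed (simp_all add: F.diff_subst_add)
qed

section \<open>Differential identities\<close>

text \<open>
  Stability under substitutions is the composition of homomorphisms: a substitution followed by an
  evaluation in A is again an evaluation in A.
\<close>

lemma TL_ideal_diff_Id:
  assumes A: "L_algebra A"
  shows "TL_ideal B (diff_Id B A)"
proof -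
  interpret F: L_algebra "free_L_alg B" by (rule L_algebra_free)
  interpret L_algebra A by fact
  note hom = L_hom_diff_subst[OF A]
  have sub: "pm.subspace (diff_Id B A)"
    by (rule pm.subspaceI)
      (auto simp: diff_Id_def diff_subst_add diff_subst_scale F.add_closed 
        pm.subspace_scale[OF subspace_free_carr])
  have der: "der (free_L_alg B) f \<in> diff_Id B A" if "f \<in> diff_Id B A" for f
    using that L_hom.hom_der[OF hom] by (simp add: diff_Id_def F.der_closed)
  show ?thesis
    unfolding TL_ideal_def
  proof (intro conjI ballI allI impI)
    fix f h assume f: "f \<in> diff_Id B A"
    show "U_act (free_L_alg B) h f \<in> diff_Id B A"
      by (rule F.U_act_in_subspace[OF _ der f]) (simp add: free_L_alg_simps(2) sub)
  next
    fix f and \<psi> :: "nat \<Rightarrow> 'f diff_poly"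
    assume f: "f \<in> diff_Id B A" and \<psi>: "\<forall>j. \<psi> j \<in> carr (free_L_alg B)"
    have "diff_subst A \<phi> (diff_subst (free_L_alg B) \<psi> f) = 0" if "\<forall>j. \<phi> j \<in> carr A" for \<phi>
      using L_hom.hom_diff_subst[OF hom[OF that] \<psi>] f
      by (simp add: diff_Id_def diff_subst_closed that)
    then show "diff_subst (free_L_alg B) \<psi> f \<in> diff_Id B A"
      by (simp add: diff_Id_def F.diff_subst_closed \<psi>)
  next
    fix f g assume "f \<in> diff_Id B A" "g \<in> carr (free_L_alg B)"
    then show "f * g \<in> diff_Id B A" "g * f \<in> diff_Id B A"
      using F.mul_closed by (auto simp: diff_Id_def diff_subst_mult A diff_subst_closed free_L_alg_simps(3))
  qed (auto simp: sub, simp add: diff_Id_def)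
qed

end

lemma TL_generated_subset: "\<lbrakk>TL_ideal B I; S \<subseteq> I\<rbrakk> \<Longrightarrow> TL_generated B S \<subseteq> I"
  unfolding TL_generated_def by blast

lemma diff_Id_eq_TL_generatedI:
  assumes B: "U_basis B" and A: "L_algebra A" and S: "S \<subseteq> diff_Id B A"
    and I: "\<And>I. \<lbrakk>TL_ideal B I; S \<subseteq> I\<rbrakk> \<Longrightarrow> diff_Id B A \<subseteq> I"
  shows "diff_Id B A = TL_generated B S"
  using TL_generated_subset[OF TL_ideal_diff_Id[OF B A] S] I unfolding TL_generated_def by blast

section \<open>Linear independence of monomial functions\<close>

text \<open>
  Scaling one variable by k scales a monomial by a power of k that reveals the exponent of that
  variable. With k = 2 the powers are distinct in characteristic zero, and distinct monomials can be
  told apart.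
\<close>

lemma prod_mset_fun_upd:
  fixes \<rho> :: "'v \<Rightarrow> 'f::comm_semiring_1"
  shows "(\<Prod>y\<in>#\<mu>. (\<rho>(x := k * \<rho> x)) y) = k ^ count \<mu> x * (\<Prod>y\<in>#\<mu>. \<rho> y)"
  by (induction \<mu>) (auto simp: algebra_simps)

text \<open>
  The argument is Dedekind's for the independence of characters. Replacing x by 2x in the relation
  and subtracting the appropriate multiple of the original one removes the term of \<open>\<nu>\<close>, while it
  multiplies the coefficients of the monomials whose degree in x differs from that of \<open>\<nu>\<close> by
  nonzero constants.
\<close>

lemma monomial_functions_independent:
  fixes c :: "'v multiset \<Rightarrow> 'f::field_char_0"
  assumes "finite S" "\<And>\<rho>. (\<Sum>\<mu>\<in>S. c \<mu> * (\<Prod>x\<in>#\<mu>. \<rho> x)) = 0" "\<mu> \<in> S"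
  shows "c \<mu> = 0"
  using assms
proof (induction S arbitrary: c \<mu> rule: finite_induct)
  case (insert \<nu> S)
  have rest: "c \<mu> = 0" if \<mu>: "\<mu> \<in> S" for \<mu>
  proof -
    from \<mu> insert.hyps obtain x where x: "count \<mu> x \<noteq> count \<nu> x"
      by (metis multiset_eq_iff)
    let ?d = "\<lambda>\<mu>. 2 ^ count \<mu> x - 2 ^ count \<nu> x :: 'f"
    have "(\<Sum>\<mu>\<in>S. c \<mu> * ?d \<mu> * (\<Prod>y\<in>#\<mu>. \<rho> y)) = 0" for \<rho>
    proof -
      have "(\<Sum>\<mu>\<in>insert \<nu> S. c \<mu> * ?d \<mu> * (\<Prod>y\<in>#\<mu>. \<rho> y))
          = (\<Sum>\<mu>\<in>insert \<nu> S. c \<mu> * (\<Prod>y\<in>#\<mu>. (\<rho>(x := 2 * \<rho> x)) y))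
            - 2 ^ count \<nu> x * (\<Sum>\<mu>\<in>insert \<nu> S. c \<mu> * (\<Prod>y\<in>#\<mu>. \<rho> y))"
        unfolding prod_mset_fun_upd sum_distrib_left sum_subtractf[symmetric]
        by (rule sum.cong) (simp_all add: algebra_simps)
      also have "\<dots> = 0" by (simp only: insert.prems(1)) simp
      finally show ?thesis using insert.hyps by simp
    qed
    then have "c \<mu> * ?d \<mu> = 0" by (rule insert.IH) (rule \<mu>)
    moreover have "?d \<mu> \<noteq> 0"
    proof
      assume "?d \<mu> = 0"
      then have "(of_nat (2 ^ count \<mu> x) :: 'f) = of_nat (2 ^ count \<nu> x)" by simp
      with x show False unfolding of_nat_eq_iff by simp
    qed
    ultimately show ?thesis by simp
  qed
  have "c \<nu> = 0"
    using insert.prems(1)[of "\<lambda>_. 1"] insert.hyps rest by simp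
  with rest insert.prems show ?case by auto
qed simp


text \<open>
  If a combination of monomials vanishes as a function, then so does, modulo U, the combination with
  the same coefficients of any objects that depend modulo U only on the monomial. Several indices w
  may carry the same monomial; their coefficients add up to zero.
\<close>

lemma vanishing_combination_of_monomials:
  fixes s :: "'f::field_char_0 \<Rightarrow> 'a::ab_group_add \<Rightarrow> 'a" and m :: "'w \<Rightarrow> 'v multiset"
  assumes s: "vector_space s" and U: "module.subspace s U" and S: "finite S"
    and vanish: "\<And>\<rho>. (\<Sum>w\<in>S. c w * (\<Prod>x\<in>#m w. \<rho> x)) = 0"
    and g: "\<And>w w'. \<lbrakk>w \<in> S; w' \<in> S; m w = m w'\<rbrakk> \<Longrightarrow> g w - g w' \<in> U"
  shows "(\<Sum>w\<in>S. s (c w) (g w)) \<in> U"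
proof -
  interpret vector_space s by fact
  let ?F = "\<lambda>\<mu>. {w \<in> S. m w = \<mu>}"
  have fibre: "(\<Sum>w\<in>?F \<mu>. c w) = 0" if "\<mu> \<in> m ` S" for \<mu>
  proof (rule monomial_functions_independent[of "m ` S"])
    fix \<rho>
    have "(\<Sum>\<mu>\<in>m ` S. (\<Sum>w\<in>?F \<mu>. c w) * (\<Prod>x\<in>#\<mu>. \<rho> x))
        = (\<Sum>\<mu>\<in>m ` S. \<Sum>w\<in>?F \<mu>. c w * (\<Prod>x\<in>#m w. \<rho> x))"
      by (simp add: sum_distrib_right)
    also have "\<dots> = 0"
      using sum.image_gen[OF S, of "\<lambda>w. c w * (\<Prod>x\<in>#m w. \<rho> x)" m] vanish by simp
    finally show "(\<Sum>\<mu>\<in>m ` S. (\<Sum>w\<in>?F \<mu>. c w) * (\<Prod>x\<in>#\<mu>. \<rho> x)) = 0" .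
  qed (use S that in auto)
  have "(\<Sum>w\<in>?F \<mu>. s (c w) (g w)) \<in> U" if "\<mu> \<in> m ` S" for \<mu>
  proof -
    from that obtain r where r: "r \<in> ?F \<mu>" by auto
    have "(\<Sum>w\<in>?F \<mu>. s (c w) (g w))
        = (\<Sum>w\<in>?F \<mu>. s (c w) (g w - g r)) + s (\<Sum>w\<in>?F \<mu>. c w) (g r)"
      by (simp add: scale_right_diff_distrib sum_subtractf scale_sum_left)
    also have "\<dots> = (\<Sum>w\<in>?F \<mu>. s (c w) (g w - g r))"
      using fibre[OF that] by simp
    also have "\<dots> \<in> U"
      using r by (intro subspace_sum subspace_scale U g) auto
    finally show ?thesis .
  qed
  then have "(\<Sum>\<mu>\<in>m ` S. \<Sum>w\<in>?F \<mu>. s (c w) (g w)) \<in> U"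
    by (rule subspace_sum[OF U])
  then show ?thesis
    by (subst sum.image_gen[OF S, of "\<lambda>w. s (c w) (g w)" m])
qed

section \<open>Normal forms of differential polynomials\<close>

text \<open>
  The four generators for \<open>M\<^sub>1\<close>, read as congruences modulo a two-sided ideal I of an algebra A with
  derivation. The algebra A is left open because three instances matter: the free algebra with a
  T-ideal, its opposite (for the identities of \<open>M\<^sub>2\<close>), and \<open>M\<^sub>1\<close> itself with the zero ideal, where the
  normal forms below become an evaluation formula.
\<close>

locale M1_congruences = L_algebra A
  for A :: "('f::field_char_0, 'a::ab_group_add) L_alg" +
  fixes I :: "'a set"
  assumes I_subspace: "module.subspace (scl A) I"
    and I_mul: "\<lbrakk>u \<in> I; a \<in> carr A\<rbrakk> \<Longrightarrow> mul A u a \<in> I \<and> mul A a u \<in> I"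
    and tails_commute: "\<lbrakk>a \<in> carr A; b \<in> carr A; c \<in> carr A\<rbrakk>
          \<Longrightarrow> mul A a (mul A b c - mul A c b) \<in> I"
    and der_swap: "\<lbrakk>a \<in> carr A; b \<in> carr A\<rbrakk> \<Longrightarrow> mul A (der A a) b - mul A (der A b) a \<in> I"
    and mul_der: "\<lbrakk>a \<in> carr A; b \<in> carr A\<rbrakk> \<Longrightarrow> mul A a (der A b) \<in> I"
    and der_der: "a \<in> carr A \<Longrightarrow> der A (der A a) \<in> I"
begin

definition cong_mod :: "'a \<Rightarrow> 'a \<Rightarrow> bool" (infix "\<approx>" 50) where
  "a \<approx> b \<longleftrightarrow> a - b \<in> I"

lemma cong_mod_refl [simp]: "a \<approx> a"
  by (simp add: cong_mod_def vs.subspace_0[OF I_subspace])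

lemma cong_mod_sym: "a \<approx> b \<Longrightarrow> b \<approx> a"
  unfolding cong_mod_def using vs.subspace_neg[OF I_subspace, of "a - b"] by simp

lemma cong_mod_trans [trans]: "\<lbrakk>a \<approx> b; b \<approx> c\<rbrakk> \<Longrightarrow> a \<approx> c"
  unfolding cong_mod_def using vs.subspace_add[OF I_subspace, of "a - b" "b - c"] by simp

lemma cong_mod_scl: "a \<approx> a' \<Longrightarrow> scl A c a \<approx> scl A c a'"
  unfolding cong_mod_def using vs.subspace_scale[OF I_subspace]
  by (simp flip: vs.scale_right_diff_distrib)

lemma cong_mod_sum: "(\<And>i. i \<in> S \<Longrightarrow> g i \<approx> g' i) \<Longrightarrow> (\<Sum>i\<in>S. g i) \<approx> (\<Sum>i\<in>S. g' i)"
  unfolding cong_mod_def by (simp flip: sum_subtractf add: vs.subspace_sum I_subspace)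

lemma cong_mod_mul_right:
  "\<lbrakk>a \<approx> a'; a \<in> carr A; a' \<in> carr A; b \<in> carr A\<rbrakk> \<Longrightarrow> mul A a b \<approx> mul A a' b"
  unfolding cong_mod_def using I_mul by (simp flip: mul_diff_left)

lemma foldl_mul_cong_mod:
  "\<lbrakk>a \<approx> a'; a \<in> carr A; a' \<in> carr A; set xs \<subseteq> carr A\<rbrakk> \<Longrightarrow> foldl (mul A) a xs \<approx> foldl (mul A) a' xs"
  by (induction xs arbitrary: a a') (auto simp: mul_closed cong_mod_mul_right)

lemma foldl_mul_scl:
  "\<lbrakk>a \<in> carr A; set xs \<subseteq> carr A\<rbrakk> \<Longrightarrow> foldl (mul A) (scl A c a) xs = scl A c (foldl (mul A) a xs)"
  by (induction xs arbitrary: a) (auto simp: mul_closed mul_scl_left)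

lemma foldl_mul_add:
  "\<lbrakk>a \<in> carr A; b \<in> carr A; set xs \<subseteq> carr A\<rbrakk>
    \<Longrightarrow> foldl (mul A) (a + b) xs = foldl (mul A) a xs + foldl (mul A) b xs"
  by (induction xs arbitrary: a b) (auto simp: mul_closed mul_add_left)

text \<open>
  Products are bracketed to the left from here on, since the congruences act on the first
  factor together with the letter that follows it.
\<close>

lemma nprod_foldl:
  "\<lbrakk>a \<in> carr A; set xs \<subseteq> carr A\<rbrakk> \<Longrightarrow> nprod (mul A) (a # xs) = foldl (mul A) a xs"
proof (induction xs arbitrary: a)
  case (Cons b xs)
  then have "foldl (mul A) a (b # xs) = nprod (mul A) (mul A a b # xs)"
    by (simp add: mul_closed)
  also have "\<dots> = nprod (mul A) (a # b # xs)"
    using Cons.prems by (cases xs) (auto simp: mul_assoc intro!: mul_assoc nprod_closed)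
  finally show ?case by simp
qed simp

lemma foldl_mul_move:
  "\<lbrakk>a \<in> carr A; set xs \<subseteq> carr A; y \<in> carr A; set zs \<subseteq> carr A\<rbrakk>
    \<Longrightarrow> foldl (mul A) a (xs @ y # zs) \<approx> foldl (mul A) a (y # xs @ zs)"
proof (induction xs arbitrary: a)
  case (Cons x xs)
  then have "foldl (mul A) a ((x # xs) @ y # zs) \<approx> foldl (mul A) (mul A (mul A a x) y) (xs @ zs)"
    by (simp add: mul_closed)
  also have "\<dots> \<approx> foldl (mul A) (mul A (mul A a y) x) (xs @ zs)"
    using Cons.prems tails_commute[of a x y]
    by (intro foldl_mul_cong_mod) (simp_all add: cong_mod_def mul_closed mul_assoc mul_diff_right)
  finally show ?case by simp
qed simp

text \<open>
  By \<open>foldl_mul_move\<close>, the first letter of the tail can be brought to any position, so that induction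
  over the tail applies.
\<close>

lemma foldl_mul_perm:
  "\<lbrakk>mset xs = mset ys; a \<in> carr A; set xs \<subseteq> carr A\<rbrakk>
    \<Longrightarrow> foldl (mul A) a xs \<approx> foldl (mul A) a ys"
proof (induction xs arbitrary: ys a)
  case (Cons x xs)
  then obtain us vs where ys: "ys = us @ x # vs"
    by (metis list.set_intros(1) set_mset_mset split_list)
  have sets: "set ys \<subseteq> carr A" using Cons.prems by (metis set_mset_mset)
  have "foldl (mul A) a (x # xs) \<approx> foldl (mul A) (mul A a x) (us @ vs)"
    unfolding foldl_Cons
    using Cons.prems ys by (intro Cons.IH) (auto simp: mul_closed)
  also have "\<dots> \<approx> foldl (mul A) a ys"
    using foldl_mul_move[of a us x vs] Cons.prems sets ys by (auto intro: cong_mod_sym)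
  finally show ?case .
qed simp

text \<open>
  The letter b occurs in the tail of the first product and can be brought to its front;
  \<open>(\<delta> a) b \<equiv> (\<delta> b) a\<close> then exchanges the roles of a and b.
\<close>

lemma foldl_mul_der_perm:
  assumes "mset (a # xs) = mset (b # ys)" and "set (a # xs) \<subseteq> carr A"
  shows "foldl (mul A) (der A a) xs \<approx> foldl (mul A) (der A b) ys"
proof (cases "a = b")
  case True
  then show ?thesis using assms by (auto intro: foldl_mul_perm simp: der_closed)
next
  case False
  with assms(1) obtain Q where Q: "mset xs = add_mset b Q" "mset ys = add_mset a Q"
    by (auto simp: add_eq_conv_ex)
  obtain q where "mset q = Q" using ex_mset by blast
  with Q have q: "mset xs = mset (b # q)" "mset (a # q) = mset ys" by auto
  have sets: "a \<in> carr A" "b \<in> carr A" "set xs \<subseteq> carr A" "set q \<subseteq> carr A"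
    using assms(2) mset_eq_setD[OF q(1)] by auto
  have "foldl (mul A) (der A a) xs \<approx> foldl (mul A) (mul A (der A a) b) q"
    using foldl_mul_perm[OF q(1)] sets by (simp add: der_closed)
  also have "\<dots> \<approx> foldl (mul A) (mul A (der A b) a) q"
    using der_swap[of a b] sets
    by (intro foldl_mul_cong_mod) (auto simp: cong_mod_def mul_closed der_closed)
  also have "\<dots> \<approx> foldl (mul A) (der A b) ys"
    using foldl_mul_perm[OF q(2)] sets by (simp add: der_closed)
  finally show ?thesis .
qed

text \<open>
  The exponent differs from its constant term by a multiple of \<open>\<delta>\<close>, and \<open>a (\<delta> c)\<close> is congruent to 0.
\<close>

lemma mul_U_act_right:
  assumes "a \<in> carr A" "b \<in> carr A"
  shows "mul A a (U_act A h b) \<approx> scl A (coeff h 0) (mul A a b)"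
proof (cases h)
  case (pCons c h')
  then show ?thesis
    using assms mul_der[of a "U_act A h' b"]
    by (simp add: cong_mod_def U_act_pCons mul_add_right mul_scl_right U_act_closed scl_closed der_closed)
qed

text \<open>
  Beyond first order the exponent is a multiple of \<open>\<delta>\<^sup>2\<close>, which acts as 0 modulo the ideal.
\<close>

lemma U_act_first_order:
  assumes "b \<in> carr A"
  shows "U_act A h b \<approx> scl A (coeff h 0) b + scl A (coeff h 1) (der A b)"
proof -
  obtain c h1 where h: "h = pCons c h1" by (cases h)
  obtain d h2 where h1: "h1 = pCons d h2" by (cases h1)
  show ?thesis
    using der_der[of "U_act A h2 b"] assms
    by (simp add: cong_mod_def h h1 U_act_pCons der_add der_scl der_closed scl_closed U_act_closed)
qed

lemma foldl_mul_U_act: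
  assumes \<phi>: "\<forall>j. \<phi> j \<in> carr A" and "a \<in> carr A"
  shows "foldl (mul A) a (map (\<lambda>(j, h). U_act A h (\<phi> j)) r)
    \<approx> scl A (\<Prod>(j, h)\<leftarrow>r. coeff h 0) (foldl (mul A) a (map (\<lambda>(j, h). \<phi> j) r))"
  using assms(2)
proof (induction r arbitrary: a)
  case (Cons p r)
  obtain j h where p: "p = (j, h)" by (cases p)
  let ?k = "(\<Prod>(j, h)\<leftarrow>r. coeff h 0)"
  have U: "set (map (\<lambda>(j, h). \<phi> j) r) \<subseteq> carr A"
    using \<phi> by auto
  have "foldl (mul A) a (map (\<lambda>(j, h). U_act A h (\<phi> j)) (p # r))
      \<approx> scl A ?k (foldl (mul A) (mul A a (U_act A h (\<phi> j))) (map (\<lambda>(j, h). \<phi> j) r))"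
    using Cons \<phi> by (simp add: p mul_closed U_act_closed)
  also have "\<dots> \<approx> scl A ?k (foldl (mul A) (scl A (coeff h 0) (mul A a (\<phi> j))) (map (\<lambda>(j, h). \<phi> j) r))"
    using Cons.prems \<phi> U
    by (intro cong_mod_scl foldl_mul_cong_mod mul_U_act_right) (auto simp: mul_closed U_act_closed scl_closed)
  also have "\<dots> = scl A (?k * coeff h 0) (foldl (mul A) (mul A a (\<phi> j)) (map (\<lambda>(j, h). \<phi> j) r))"
    using Cons.prems \<phi> U by (subst foldl_mul_scl) (auto simp: mul_closed)
  finally show ?case by (simp add: p mult.commute)
qed simp

lemma word_val_normal_form:
  assumes \<phi>: "\<forall>j. \<phi> j \<in> carr A"
  shows "word_val A \<phi> ((i, h) # r)
    \<approx> scl A ((\<Prod>(j, h)\<leftarrow>r. coeff h 0) * coeff h 0) (foldl (mul A) (\<phi> i) (map (\<lambda>(j, h). \<phi> j) r))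
      + scl A ((\<Prod>(j, h)\<leftarrow>r. coeff h 0) * coeff h 1)
          (foldl (mul A) (der A (\<phi> i)) (map (\<lambda>(j, h). \<phi> j) r))"
proof -
  let ?k = "(\<Prod>(j, h)\<leftarrow>r. coeff h 0)" and ?t = "map (\<lambda>(j, h). \<phi> j) r"
  have t: "set ?t \<subseteq> carr A" using \<phi> by auto
  have "word_val A \<phi> ((i, h) # r)
      = foldl (mul A) (U_act A h (\<phi> i)) (map (\<lambda>(j, h). U_act A h (\<phi> j)) r)"
    using \<phi> unfolding word_val_def list.map prod.case
    by (intro nprod_foldl) (auto simp: U_act_closed)
  also have "\<dots> \<approx> scl A ?k (foldl (mul A) (U_act A h (\<phi> i)) ?t)"
    using \<phi> by (intro foldl_mul_U_act) (auto simp: U_act_closed)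
  also have "\<dots> \<approx> scl A ?k (foldl (mul A) (scl A (coeff h 0) (\<phi> i) + scl A (coeff h 1) (der A (\<phi> i))) ?t)"
    using \<phi> t
    by (intro cong_mod_scl foldl_mul_cong_mod U_act_first_order) (auto simp: U_act_closed add_closed scl_closed der_closed)
  also have "\<dots> = scl A (?k * coeff h 0) (foldl (mul A) (\<phi> i) ?t)
      + scl A (?k * coeff h 1) (foldl (mul A) (der A (\<phi> i)) ?t)"
    using \<phi> t by (simp add: foldl_mul_add foldl_mul_scl scl_closed der_closed vs.scale_right_distrib)
  finally show ?thesis .
qed

end

section \<open>Evaluation in the first algebra\<close>

lemma M1_simps:
  "scl M1_delta = mat_scale" "mul M1_delta = (**)"
  "der M1_delta m = mat_scale (m $ 2 $ 2) (mat_unit 1 2)"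
  by (simp_all add: M1_delta_def)

lemma M2_simps:
  "scl M2_delta = mat_scale" "mul M2_delta = (**)"
  "der M2_delta m = mat_scale (m $ 1 $ 1) (mat_unit 1 2)"
  by (simp_all add: M2_delta_def)

lemmas mat_entry_simps = mat_scale_def mat_unit_def matrix_matrix_mult_def vec_eq_iff forall_2 sum_2

lemma M1_congruences_M1: "M1_congruences M1_delta {0}"
proof -
  interpret L_algebra M1_delta by (rule M1_delta_L_algebra)
  show ?thesis
    by unfold_locales
      (auto simp: vs.subspace_def mem_M1_delta M1_simps, simp_all add: mat_entry_simps algebra_simps)
qed

text \<open>
  In \<open>M\<^sub>1\<close> the congruences modulo \<open>{0}\<close> are equations, and the reduction to normal forms computes
  the values of words.
\<close>

interpretation M1: M1_congruences M1_delta "{0}"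
  by (rule M1_congruences_M1)

lemma M1_foldl_mul:
  fixes m :: "'f::field_char_0^2^2"
  assumes "m \<in> carr M1_delta" "set xs \<subseteq> carr M1_delta"
  shows "foldl (**) m xs = mat_scale (\<Prod>a\<leftarrow>xs. a $ 2 $ 2) m"
  using assms
proof (induction xs arbitrary: m)
  case (Cons a xs)
  then have "m ** a = mat_scale (a $ 2 $ 2) m"
    by (auto simp: mem_M1_delta, simp_all add: mat_entry_simps)
  then show ?case
    using Cons by (simp add: M1.scl_closed[unfolded M1_simps] mult.commute)
qed simp

lemma M1_word_val:
  fixes \<phi> :: "nat \<Rightarrow> 'f::field_char_0^2^2"
  assumes "\<forall>j. \<phi> j \<in> carr M1_delta"
  shows "word_val M1_delta \<phi> ((i, h) # r)
    = mat_scale ((\<Prod>(j, h)\<leftarrow>r. coeff h 0) * (\<Prod>(j, h)\<leftarrow>r. \<phi> j $ 2 $ 2))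
       (mat_scale (coeff h 0) (\<phi> i) + mat_scale (coeff h 1 * \<phi> i $ 2 $ 2) (mat_unit 1 2))"
proof -
  have "set (map (\<lambda>(j, h). \<phi> j) r) \<subseteq> carr M1_delta" using assms by auto
  moreover have "mat_scale c (mat_unit 1 2) \<in> carr M1_delta" for c :: 'f
    by (simp add: mem_M1_delta mat_scale_def mat_unit_def)
  ultimately show ?thesis
    using M1.word_val_normal_form[OF assms, of i h r] assms
    unfolding M1.cong_mod_def M1_simps
    by (simp add: M1_foldl_mul mt.scale_right_distrib
       o_def case_prod_unfold mult_ac)
qed

text \<open>
  The values of f in \<open>M\<^sub>1\<close> and in A are combinations of normal forms with the same coefficients. In
  \<open>M\<^sub>1\<close> the normal forms are monomials, so the coefficients that belong to a common monomial cancel;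
  in A the normal forms that belong to a common monomial are congruent modulo I.
\<close>

lemma (in M1_congruences) M1_identity_in_ideal:
  assumes f: "f \<in> diff_Id B (M1_delta :: ('f, 'f^2^2) L_alg)" and \<phi>: "\<forall>j. \<phi> j \<in> carr A"
  shows "diff_subst A \<phi> f \<in> I"
proof -
  let ?K = "Poly_Mapping.keys f" and ?c = "Poly_Mapping.lookup f"
  define hv where "hv w = fst (hd (letters w))" for w :: "(nat \<times> 'f poly) nc_word"
  define hc where "hc w k = coeff (snd (hd (letters w))) k" for w :: "(nat \<times> 'f poly) nc_word" and k
  define tv where "tv w = map fst (tl (letters w))" for w :: "(nat \<times> 'f poly) nc_word"
  define e where "e w = ?c w * (\<Prod>(j, h)\<leftarrow>tl (letters w). coeff h 0)" for w
  have nonempty: "letters w = (hv w, snd (hd (letters w))) # tl (letters w)" if "w \<in> ?K" for w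
    using f that by (cases "letters w") (auto simp: diff_Id_def free_L_alg_def hv_def)
  let ?gA = "\<lambda>w. foldl (mul A) (\<phi> (hv w)) (map \<phi> (tv w))"
  let ?gB = "\<lambda>w. foldl (mul A) (der A (\<phi> (hv w))) (map \<phi> (tv w))"
  have eval: "(\<Sum>w\<in>?K. e w * (\<Prod>j\<leftarrow>tv w. t j) * (hc w 0 * s (hv w) + hc w 1 * t (hv w))) = 0" for s t
  proof -
    define \<psi> where "\<psi> j = mat_scale (t j) (mat_unit 2 2) + mat_scale (s j) (mat_unit 1 2)" for j
    have \<psi>: "\<forall>j. \<psi> j \<in> carr M1_delta" by (auto simp: \<psi>_def M1_delta_def)
    have entry: "\<psi> j $ 2 $ 2 = t j" "\<psi> j $ 1 $ 2 = s j" for j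
      by (simp_all add: \<psi>_def mat_scale_def mat_unit_def)
    have "word_val M1_delta \<psi> (letters w) $ 1 $ 2
        = (\<Prod>(j, h)\<leftarrow>tl (letters w). coeff h 0) * (\<Prod>j\<leftarrow>tv w. t j)
          * (hc w 0 * s (hv w) + hc w 1 * t (hv w))" if "w \<in> ?K" for w
      by (subst nonempty[OF that], subst M1_word_val[OF \<psi>])
        (simp add: entry tv_def hc_def mat_scale_def mat_unit_def o_def case_prod_unfold)
    moreover have "diff_subst M1_delta \<psi> f $ 1 $ 2 = 0"
      using f \<psi> by (simp add: diff_Id_def)
    ultimately show ?thesis
      by (simp add: diff_subst_word_val lin_ext_def M1_simps mat_scale_def e_def mult.assoc)
  qed
  \<comment> \<open>Setting all s to zero isolates the normal forms that begin with a derivative.\<close>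
  have B0: "(\<Sum>w\<in>?K. (e w * hc w 1) * (\<Prod>j\<in>#mset (hv w # tv w). t j)) = 0" for t
    using eval[where s = "\<lambda>_. 0" and t = t]
    by (simp add: mult_ac flip: prod_mset_prod_list)
  \<comment> \<open>Subtracting them leaves the normal forms without derivative. The monomials live in the disjoint union of two copies
  of the variables, \<open>Inl\<close> for s and \<open>Inr\<close> for t, so that they determine the first letter.\<close>
  have A0: "(\<Sum>w\<in>?K. (e w * hc w 0) *
      (\<Prod>j\<in>#add_mset (Inl (hv w)) (image_mset Inr (mset (tv w))). \<rho> j)) = 0" for \<rho> :: "nat + nat \<Rightarrow> 'f"
    using eval[where s = "\<lambda>j. \<rho> (Inl j)" and t = "\<lambda>j. \<rho> (Inr j)"] B0[of "\<lambda>j. \<rho> (Inr j)"]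
    by (simp add: algebra_simps sum.distrib image_mset.compositionality o_def flip: prod_mset_prod_list)
  have sets: "set (map \<phi> (tv w)) \<subseteq> carr A" for w using \<phi> by auto
  let ?SA = "\<Sum>w\<in>?K. scl A (e w * hc w 0) (?gA w)"
  let ?SB = "\<Sum>w\<in>?K. scl A (e w * hc w 1) (?gB w)"
  have "?SA \<in> I"
  proof (rule vanishing_combination_of_monomials[OF scl_vector_space I_subspace _ A0])
    fix w w'
    assume eq: "add_mset (Inl (hv w)) (image_mset Inr (mset (tv w)))
      = add_mset (Inl (hv w')) (image_mset Inr (mset (tv w')))"
    have "hv w = hv w'"
      using arg_cong[OF eq, of "\<lambda>M. Inl (hv w) \<in># M"] by auto
    with eq have "mset (tv w) = mset (tv w')"
      using multiset.inj_map_strong[of _ _ Inr Inr] by auto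
    with \<open>hv w = hv w'\<close> show "?gA w - ?gA w' \<in> I"
      using foldl_mul_perm[of "map \<phi> (tv w)" "map \<phi> (tv w')" "\<phi> (hv w)"] \<phi> sets
      by (simp add: cong_mod_def)
  qed simp
  moreover have "?SB \<in> I"
  proof (rule vanishing_combination_of_monomials[OF scl_vector_space I_subspace _ B0])
    fix w w' assume "mset (hv w # tv w) = mset (hv w' # tv w')"
    then have "mset (map \<phi> (hv w # tv w)) = mset (map \<phi> (hv w' # tv w'))"
      by (simp only: mset_map)
    then show "?gB w - ?gB w' \<in> I"
      using foldl_mul_der_perm[of "\<phi> (hv w)" "map \<phi> (tv w)" "\<phi> (hv w')" "map \<phi> (tv w')"] \<phi> sets
      by (simp add: cong_mod_def)
  qed simp
  moreover have "diff_subst A \<phi> f \<approx> ?SA + ?SB"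
    unfolding diff_subst_word_val lin_ext_def sum.distrib[symmetric]
  proof (rule cong_mod_sum)
    fix w assume w: "w \<in> ?K"
    have "(\<lambda>(j, h). \<phi> j) = \<phi> \<circ> (fst :: nat \<times> 'f poly \<Rightarrow> nat)" by auto
    then have "word_val A \<phi> (letters w)
        \<approx> scl A ((\<Prod>(j, h)\<leftarrow>tl (letters w). coeff h 0) * hc w 0) (?gA w)
          + scl A ((\<Prod>(j, h)\<leftarrow>tl (letters w). coeff h 0) * hc w 1) (?gB w)"
      using word_val_normal_form[OF \<phi>, of "hv w" "snd (hd (letters w))" "tl (letters w)"]
      by (subst nonempty[OF w]) (simp add: hc_def tv_def)
    from cong_mod_scl[OF this, of "?c w"]
    show "scl A (?c w) (word_val A \<phi> (letters w))
        \<approx> scl A (e w * hc w 0) (?gA w) + scl A (e w * hc w 1) (?gB w)"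
      by (simp add: vs.scale_right_distrib e_def mult.assoc)
  qed
  ultimately have "(diff_subst A \<phi> f - (?SA + ?SB)) + (?SA + ?SB) \<in> I"
    unfolding cong_mod_def by (intro vs.subspace_add[OF I_subspace])
  then show ?thesis by simp
qed

section \<open>Opposite algebras\<close>

definition op_alg :: "('f, 'a) L_alg \<Rightarrow> ('f, 'a) L_alg" where
  "op_alg A = A\<lparr>mul := \<lambda>a b. mul A b a\<rparr>"

lemma op_alg_simps [simp]:
  "carr (op_alg A) = carr A" "scl (op_alg A) = scl A" "mul (op_alg A) a b = mul A b a"
  "der (op_alg A) = der A"
  by (simp_all add: op_alg_def)

lemma U_act_op [simp]: "U_act (op_alg A) = U_act A"
  by (simp add: U_act_def fun_eq_iff)

lemma (in L_algebra) L_algebra_op: "L_algebra (op_alg A)"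
  using scl_vector_space carr_subspace
  by (intro L_algebra.intro)
    (simp_all add: mul_closed mul_assoc mul_add_left mul_add_right mul_scl_left mul_scl_right
      der_closed der_add der_scl der_mul add.commute)

definition rev_poly :: "'f::field_char_0 diff_poly \<Rightarrow> 'f diff_poly" where
  "rev_poly = lin_ext pm_scale (\<lambda>w. wd (rev (letters w)))"

lemma rev_poly_single [simp]:
  "rev_poly (Poly_Mapping.single (NCWord xs) c) = Poly_Mapping.single (NCWord (rev xs)) c"
  by (simp add: rev_poly_def)

lemma linear_rev_poly: "Vector_Spaces.linear pm_scale pm_scale rev_poly"
  unfolding rev_poly_def by (rule pm.linear_lin_ext)

lemma
  shows rev_poly_0 [simp]: "rev_poly 0 = 0"
    and rev_poly_add: "rev_poly (p + q) = rev_poly p + rev_poly q"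
  by (simp_all add: rev_poly_def pm.lin_ext_add)

lemma rev_poly_rev_poly [simp]: "rev_poly (rev_poly p) = p"
  using subset_UNIV
proof (induction p rule: keys_induct)
  case (single w c)
  show ?case by (cases w) simp
qed (simp_all add: rev_poly_add)

lemma rev_poly_closed: "f \<in> carr (free_L_alg B) \<Longrightarrow> rev_poly f \<in> carr (free_L_alg B)"
  unfolding rev_poly_def
  by (intro pm.lin_ext_in_subspace subspace_free_carr wd_closed) (auto simp: free_L_alg_simps admissible_def)

lemma (in L_algebra) word_val_op:
  assumes "\<forall>j. \<phi> j \<in> carr A"
  shows "word_val (op_alg A) \<phi> xs = word_val A \<phi> (rev xs)"
proof -
  interpret op: L_algebra "op_alg A" by (rule L_algebra_op)
  show ?thesis
  proof (induction xs)
    case (Cons x xs)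
    show ?case
    proof (cases "xs = []")
      case False
      then show ?thesis
        using op.word_val_append[of \<phi> "[x]" xs] word_val_append[of \<phi> "rev xs" "[x]"] assms Cons
        by (cases x) simp
    qed (cases x, simp)
  qed (simp add: word_val_def)
qed

lemma (in L_algebra) diff_subst_op:
  assumes "\<forall>j. \<phi> j \<in> carr A"
  shows "diff_subst (op_alg A) \<phi> f = diff_subst A \<phi> (rev_poly f)"
proof -
  interpret op: L_algebra "op_alg A" by (rule L_algebra_op)
  show ?thesis
    using subset_UNIV
  proof (induction f rule: keys_induct)
    case (single w c)
    show ?case by (cases w) (simp add: word_val_op assms)
  qed (simp_all add: rev_poly_add diff_subst_add op.diff_subst_add)
qed

section \<open>The second algebra is opposite to the first\<close>

text \<open>
  This is \<open>J m\<^sup>T J\<close> for the permutation matrix J that exchanges the two indices: an involutive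
  anti-automorphism of the full matrix algebra that fixes \<open>e\<^sub>1\<^sub>2\<close> and exchanges \<open>e\<^sub>1\<^sub>1\<close> and \<open>e\<^sub>2\<^sub>2\<close>.
\<close>

definition anti_transpose :: "'f^2^2 \<Rightarrow> 'f::field_char_0^2^2" where
  "anti_transpose m = (\<chi> i j. m $ (if j = 1 then 2 else 1) $ (if i = 1 then 2 else 1))"

lemma anti_transpose_entries:
  "anti_transpose m $ 1 $ 1 = m $ 2 $ 2" "anti_transpose m $ 1 $ 2 = m $ 1 $ 2"
  "anti_transpose m $ 2 $ 1 = m $ 2 $ 1" "anti_transpose m $ 2 $ 2 = m $ 1 $ 1"
  by (simp_all add: anti_transpose_def)

lemma anti_transpose_involution [simp]: "anti_transpose (anti_transpose m) = m"
  by (simp add: vec_eq_iff forall_2 anti_transpose_entries)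

lemma anti_transpose_M1: "m \<in> carr M1_delta \<Longrightarrow> anti_transpose m \<in> carr M2_delta"
  by (simp add: mem_M1_delta mem_M2_delta anti_transpose_entries)

lemma L_hom_anti_transpose: "L_hom M2_delta (op_alg M1_delta) anti_transpose"
proof -
  interpret M2: L_algebra M2_delta by (rule M2_delta_L_algebra)
  interpret op: L_algebra "op_alg M1_delta" by (rule M1.L_algebra_op)
  show ?thesis
    by unfold_locales
      (auto simp: mem_M1_delta mem_M2_delta anti_transpose_entries vec_eq_iff forall_2
        M1_simps M2_simps mat_scale_def mat_unit_def matrix_matrix_mult_def sum_2)
qed

text \<open>
  \<open>M\<^sub>2\<close> is isomorphic to the opposite of \<open>M\<^sub>1\<close>, and evaluating a polynomial in an opposite algebra
  amounts to evaluating the reversed polynomial in the original one.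
\<close>

lemma diff_Id_M2_iff:
  "f \<in> diff_Id B M2_delta \<longleftrightarrow> rev_poly f \<in> diff_Id B (M1_delta :: ('f::field_char_0, 'f^2^2) L_alg)"
proof -
  let ?M1 = "M1_delta :: ('f, 'f^2^2) L_alg" and ?M2 = "M2_delta :: ('f, 'f^2^2) L_alg"
  interpret \<theta>: L_hom ?M2 "op_alg ?M1" anti_transpose by (rule L_hom_anti_transpose)
  have eq: "anti_transpose (diff_subst ?M2 \<phi> f) = diff_subst ?M1 (\<lambda>j. anti_transpose (\<phi> j)) (rev_poly f)"
    if "\<forall>j. \<phi> j \<in> carr M2_delta" for \<phi> and f :: "'f diff_poly"
  proof -
    have "\<forall>j. anti_transpose (\<phi> j) \<in> carr ?M1" using that \<theta>.hom_closed by simp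
    then show ?thesis using \<theta>.hom_diff_subst[OF that] by (simp add: M1.diff_subst_op)
  qed
  show ?thesis
  proof
    assume f: "f \<in> diff_Id B ?M2"
    show "rev_poly f \<in> diff_Id B ?M1"
      unfolding diff_Id_def
    proof (intro CollectI conjI allI impI)
      fix \<phi> :: "nat \<Rightarrow> 'f^2^2" assume "\<forall>j. \<phi> j \<in> carr M1_delta"
      then have \<psi>: "\<forall>j. anti_transpose (\<phi> j) \<in> carr M2_delta" by (simp add: anti_transpose_M1)
      then show "diff_subst M1_delta \<phi> (rev_poly f) = 0"
        using eq[OF \<psi>, of f] f by (simp add: diff_Id_def)
    qed (use f in \<open>simp add: diff_Id_def rev_poly_closed\<close>)
  next
    assume f: "rev_poly f \<in> diff_Id B ?M1"
    show "f \<in> diff_Id B ?M2"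
      unfolding diff_Id_def
    proof (intro CollectI conjI allI impI)
      fix \<phi> :: "nat \<Rightarrow> 'f^2^2" assume \<phi>: "\<forall>j. \<phi> j \<in> carr M2_delta"
      then have "\<forall>j. anti_transpose (\<phi> j) \<in> carr M1_delta" using \<theta>.hom_closed by simp
      then have "anti_transpose (diff_subst M2_delta \<phi> f) = 0"
        using eq[OF \<phi>, of f] f by (simp add: diff_Id_def)
      then show "diff_subst M2_delta \<phi> f = 0"
        by (metis anti_transpose_involution \<theta>.hom_0)
    qed (use f rev_poly_closed[of "rev_poly f" B] in \<open>simp add: diff_Id_def\<close>)
  qed
qed

section \<open>The ideals of identities\<close>

context
  fixes B :: "'f::field_char_0 poly set"
  assumes B: "U_basis B"
begin

lemma substituted_generators:
  assumes A: "L_algebra A" and \<phi>: "\<forall>j. \<phi> j \<in> carr A"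
  shows "diff_subst A \<phi> (dvar B x 1 * (dvar B y 1 * dvar B z 1 - dvar B z 1 * dvar B y 1))
        = mul A (\<phi> x) (mul A (\<phi> y) (\<phi> z) - mul A (\<phi> z) (\<phi> y))"
    and "diff_subst A \<phi> (dvar B x delta * dvar B y 1 - dvar B y delta * dvar B x 1)
        = mul A (der A (\<phi> x)) (\<phi> y) - mul A (der A (\<phi> y)) (\<phi> x)"
    and "diff_subst A \<phi> (dvar B x 1 * dvar B y delta) = mul A (\<phi> x) (der A (\<phi> y))"
    and "diff_subst A \<phi> (dvar B x (delta ^ 2)) = der A (der A (\<phi> x))"
    and "diff_subst A \<phi> ((dvar B x 1 * dvar B y 1 - dvar B y 1 * dvar B x 1) * dvar B z 1)
        = mul A (mul A (\<phi> x) (\<phi> y) - mul A (\<phi> y) (\<phi> x)) (\<phi> z)"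
    and "diff_subst A \<phi> (dvar B x 1 * dvar B y delta - dvar B y 1 * dvar B x delta)
        = mul A (\<phi> x) (der A (\<phi> y)) - mul A (\<phi> y) (der A (\<phi> x))"
    and "diff_subst A \<phi> (dvar B x delta * dvar B y 1) = mul A (der A (\<phi> x)) (\<phi> y)"
proof -
  interpret L_algebra A by fact
  have U: "U_act A delta (\<phi> j) = der A (\<phi> j)" "U_act A 1 (\<phi> j) = \<phi> j"
    "U_act A (delta ^ 2) (\<phi> j) = der A (der A (\<phi> j))" for j
    using \<phi> unfolding power2_eq_square
    by (simp_all only: U_act_one U_act_delta U_act_delta_times)
  note rules = diff_subst_diff diff_subst_mult[OF B A \<phi>] diff_subst_dvar[OF B A] U
    dvar_closed[OF B] free_mult_closed pm.subspace_diff[OF subspace_free_carr]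
  show "diff_subst A \<phi> (dvar B x 1 * (dvar B y 1 * dvar B z 1 - dvar B z 1 * dvar B y 1))
      = mul A (\<phi> x) (mul A (\<phi> y) (\<phi> z) - mul A (\<phi> z) (\<phi> y))"
    by (simp only: rules)
  show "diff_subst A \<phi> (dvar B x delta * dvar B y 1 - dvar B y delta * dvar B x 1)
      = mul A (der A (\<phi> x)) (\<phi> y) - mul A (der A (\<phi> y)) (\<phi> x)"
    by (simp only: rules)
  show "diff_subst A \<phi> (dvar B x 1 * dvar B y delta) = mul A (\<phi> x) (der A (\<phi> y))"
    by (simp only: rules)
  show "diff_subst A \<phi> (dvar B x (delta ^ 2)) = der A (der A (\<phi> x))"
    by (simp only: rules)
  show "diff_subst A \<phi> ((dvar B x 1 * dvar B y 1 - dvar B y 1 * dvar B x 1) * dvar B z 1)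
      = mul A (mul A (\<phi> x) (\<phi> y) - mul A (\<phi> y) (\<phi> x)) (\<phi> z)"
    by (simp only: rules)
  show "diff_subst A \<phi> (dvar B x 1 * dvar B y delta - dvar B y 1 * dvar B x delta)
      = mul A (\<phi> x) (der A (\<phi> y)) - mul A (\<phi> y) (der A (\<phi> x))"
    by (simp only: rules)
  show "diff_subst A \<phi> (dvar B x delta * dvar B y 1) = mul A (der A (\<phi> x)) (\<phi> y)"
    by (simp only: rules)
qed

lemma generators_closed:
  "{dvar B x 1 * (dvar B y 1 * dvar B z 1 - dvar B z 1 * dvar B y 1),
    dvar B x delta * dvar B y 1 - dvar B y delta * dvar B x 1,
    dvar B x 1 * dvar B y delta, dvar B x (delta ^ 2),
    (dvar B x 1 * dvar B y 1 - dvar B y 1 * dvar B x 1) * dvar B z 1,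
    dvar B x 1 * dvar B y delta - dvar B y 1 * dvar B x delta,
    dvar B x delta * dvar B y 1} \<subseteq> carr (free_L_alg B)"
  by (simp add: dvar_closed[OF B] free_mult_closed pm.subspace_diff[OF subspace_free_carr])

lemma TL_ideal_substitution:
  assumes "TL_ideal B I" "f \<in> I" "a \<in> carr (free_L_alg B)" "b \<in> carr (free_L_alg B)" "c \<in> carr (free_L_alg B)"
  shows "diff_subst (free_L_alg B) (\<lambda>j. if j = x then a else if j = y then b else c) f \<in> I"
  using assms unfolding TL_ideal_def by auto

text \<open>
  A T-ideal that contains the generators contains all their values on the free algebra, hence
  satisfies the congruences; so it contains the value of any identity of \<open>M\<^sub>1\<close> at the free
  generators, which is the identity itself.
\<close>

theorem diff_Id_M1:
  assumes xyz: "distinct [x, y, z]"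
  shows "diff_Id B (M1_delta :: ('f, 'f^2^2) L_alg) = TL_generated B
       {dvar B x 1 * (dvar B y 1 * dvar B z 1 - dvar B z 1 * dvar B y 1),
        dvar B x delta * dvar B y 1 - dvar B y delta * dvar B x 1,
        dvar B x 1 * dvar B y delta,
        dvar B x (delta ^ 2)}" (is "_ = TL_generated B ?S")
proof (rule diff_Id_eq_TL_generatedI[OF B M1_delta_L_algebra])
  have "diff_subst M1_delta \<phi> g = 0" if "g \<in> ?S" and \<phi>: "\<forall>j. \<phi> j \<in> carr M1_delta" for g and \<phi> :: "nat \<Rightarrow> 'f^2^2"
  proof -
    have "\<phi> j $ 1 $ 1 = 0 \<and> \<phi> j $ 2 $ 1 = 0" for j using \<phi> by (simp add: mem_M1_delta)
    then show ?thesis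
      using that(1) substituted_generators[OF M1_delta_L_algebra \<phi>]
      by (elim insertE) (simp_all add: M1_simps mat_entry_simps)
  qed
  then show "?S \<subseteq> diff_Id B (M1_delta :: ('f, 'f^2^2) L_alg)"
    using generators_closed unfolding diff_Id_def by blast
next
  fix I assume I: "TL_ideal B I" and S: "?S \<subseteq> I"
  interpret F: L_algebra "free_L_alg B" by (rule L_algebra_free[OF B])
  interpret M1_congruences "free_L_alg B" I
  proof
    fix a b c assume abc: "a \<in> carr (free_L_alg B)" "b \<in> carr (free_L_alg B)" "c \<in> carr (free_L_alg B)"
    let ?\<phi> = "\<lambda>j. if j = x then a else if j = y then b else c"
    have \<phi>: "\<forall>j. ?\<phi> j \<in> carr (free_L_alg B)" using abc by simp
    note gens = substituted_generators[OF F.L_algebra_axioms \<phi>]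
    have "dvar B x 1 * (dvar B y 1 * dvar B z 1 - dvar B z 1 * dvar B y 1) \<in> I" using S by simp
    from TL_ideal_substitution[OF I this abc, of x y]
    show "mul (free_L_alg B) a (mul (free_L_alg B) b c - mul (free_L_alg B) c b) \<in> I"
      using gens(1)[of x y z] xyz by simp
  next
    fix a b assume abc: "a \<in> carr (free_L_alg B)" "b \<in> carr (free_L_alg B)"
    let ?\<phi> = "\<lambda>j. if j = x then a else if j = y then b else b"
    have \<phi>: "\<forall>j. ?\<phi> j \<in> carr (free_L_alg B)" using abc by simp
    note gens = substituted_generators[OF F.L_algebra_axioms \<phi>]
    have *: "diff_subst (free_L_alg B) ?\<phi> g \<in> I" if "g \<in> ?S" for g
      using that TL_ideal_substitution[OF I _ abc abc(2)] S by blast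
    show "mul (free_L_alg B) (der (free_L_alg B) a) b - mul (free_L_alg B) (der (free_L_alg B) b) a \<in> I"
      using *[of "dvar B x delta * dvar B y 1 - dvar B y delta * dvar B x 1"] gens(2)[of x y] xyz by simp
    show "mul (free_L_alg B) a (der (free_L_alg B) b) \<in> I"
      using *[of "dvar B x 1 * dvar B y delta"] gens(3)[of x y] xyz by simp
    show "der (free_L_alg B) (der (free_L_alg B) a) \<in> I"
      using *[of "dvar B x (delta ^ 2)"] gens(4)[of x] xyz by simp
  qed (use I in \<open>auto simp: TL_ideal_def free_L_alg_simps(2,3)\<close>)
  show "diff_Id B (M1_delta :: ('f, 'f^2^2) L_alg) \<subseteq> I"
  proof
    fix f assume f: "f \<in> diff_Id B (M1_delta :: ('f, 'f^2^2) L_alg)"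
    then have "diff_subst (free_L_alg B) (\<lambda>j. dvar B j 1) f \<in> I"
      by (rule M1_identity_in_ideal) (simp add: dvar_closed[OF B])
    with f show "f \<in> I" by (simp add: diff_subst_id[OF B] diff_Id_def)
  qed
qed

text \<open>
  Read in the opposite of the free algebra, the generators for \<open>M\<^sub>2\<close> are the congruences for \<open>M\<^sub>1\<close>.
  The reversal of an identity of \<open>M\<^sub>2\<close> is an identity of \<open>M\<^sub>1\<close>, and its value in the opposite algebra
  undoes the reversal.
\<close>

theorem diff_Id_M2:
  assumes xyz: "distinct [x, y, z]"
  shows "diff_Id B (M2_delta :: ('f, 'f^2^2) L_alg) = TL_generated B
       {(dvar B x 1 * dvar B y 1 - dvar B y 1 * dvar B x 1) * dvar B z 1,
        dvar B x 1 * dvar B y delta - dvar B y 1 * dvar B x delta,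
        dvar B x delta * dvar B y 1,
        dvar B x (delta ^ 2)}" (is "_ = TL_generated B ?S")
proof (rule diff_Id_eq_TL_generatedI[OF B M2_delta_L_algebra])
  have "diff_subst M2_delta \<phi> g = 0" if "g \<in> ?S" and \<phi>: "\<forall>j. \<phi> j \<in> carr M2_delta" for g and \<phi> :: "nat \<Rightarrow> 'f^2^2"
  proof -
    have "\<phi> j $ 2 $ 1 = 0 \<and> \<phi> j $ 2 $ 2 = 0" for j using \<phi> by (simp add: mem_M2_delta)
    then show ?thesis
      using that(1) substituted_generators[OF M2_delta_L_algebra \<phi>]
      by (elim insertE) (simp_all add: M2_simps mat_entry_simps)
  qed
  then show "?S \<subseteq> diff_Id B (M2_delta :: ('f, 'f^2^2) L_alg)"
    using generators_closed unfolding diff_Id_def by blast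
next
  fix I assume I: "TL_ideal B I" and S: "?S \<subseteq> I"
  interpret F: L_algebra "free_L_alg B" by (rule L_algebra_free[OF B])
  interpret op: L_algebra "op_alg (free_L_alg B)" by (rule F.L_algebra_op)
  interpret M1_congruences "op_alg (free_L_alg B)" I
  proof
    fix a b c
    assume abc: "a \<in> carr (op_alg (free_L_alg B))" "b \<in> carr (op_alg (free_L_alg B))" "c \<in> carr (op_alg (free_L_alg B))"
    \<comment> \<open>The opposite multiplication turns \<open>a (b c - c b)\<close> into \<open>(c b - b c) a\<close>.\<close>
    let ?\<phi> = "\<lambda>j. if j = x then c else if j = y then b else a"
    have \<phi>: "\<forall>j. ?\<phi> j \<in> carr (free_L_alg B)" using abc by simp
    note gens = substituted_generators[OF F.L_algebra_axioms \<phi>]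
    have "(dvar B x 1 * dvar B y 1 - dvar B y 1 * dvar B x 1) * dvar B z 1 \<in> I" using S by simp
    from TL_ideal_substitution[OF I this, of c b a x y]
    show "mul (op_alg (free_L_alg B)) a (mul (op_alg (free_L_alg B)) b c - mul (op_alg (free_L_alg B)) c b) \<in> I"
      using abc gens(5)[of x y z] xyz by simp
  next
    fix a b assume abc: "a \<in> carr (op_alg (free_L_alg B))" "b \<in> carr (op_alg (free_L_alg B))"
    let ?\<phi> = "\<lambda>j. if j = x then b else if j = y then a else a"
    have \<phi>: "\<forall>j. ?\<phi> j \<in> carr (free_L_alg B)" using abc by simp
    note gens = substituted_generators[OF F.L_algebra_axioms \<phi>]
    have *: "diff_subst (free_L_alg B) ?\<phi> g \<in> I" if "g \<in> ?S" for g
      using that TL_ideal_substitution[OF I, of _ b a a x y] abc S by auto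
    show "mul (op_alg (free_L_alg B)) (der (op_alg (free_L_alg B)) a) b
        - mul (op_alg (free_L_alg B)) (der (op_alg (free_L_alg B)) b) a \<in> I"
      using *[of "dvar B x 1 * dvar B y delta - dvar B y 1 * dvar B x delta"] gens(6)[of x y] xyz by simp
    show "mul (op_alg (free_L_alg B)) a (der (op_alg (free_L_alg B)) b) \<in> I"
      using *[of "dvar B x delta * dvar B y 1"] gens(7)[of x y] xyz by simp
    show "der (op_alg (free_L_alg B)) (der (op_alg (free_L_alg B)) a) \<in> I"
      using TL_ideal_substitution[OF I, of "dvar B x (delta ^ 2)" a a a x y] S abc
        substituted_generators(4)[OF F.L_algebra_axioms, of "\<lambda>j. a" x] by (simp cong: if_cong)
  qed (use I in \<open>auto simp: TL_ideal_def free_L_alg_simps(2,3)\<close>)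
  show "diff_Id B (M2_delta :: ('f, 'f^2^2) L_alg) \<subseteq> I"
  proof
    fix f assume f: "f \<in> diff_Id B (M2_delta :: ('f, 'f^2^2) L_alg)"
    then have "rev_poly f \<in> diff_Id B (M1_delta :: ('f, 'f^2^2) L_alg)"
      by (simp add: diff_Id_M2_iff)
    then have "diff_subst (op_alg (free_L_alg B)) (\<lambda>j. dvar B j 1) (rev_poly f) \<in> I"
      by (rule M1_identity_in_ideal) (simp add: dvar_closed[OF B])
    with f show "f \<in> I"
      by (simp add: F.diff_subst_op dvar_closed[OF B] diff_subst_id[OF B] diff_Id_def)
  qed
qed

end

section \<open>Codimensions and cocharacters\<close>

lemma linear_perm_act: "Vector_Spaces.linear pm_scale pm_scale (perm_act \<sigma>)"
  unfolding perm_act_def by (rule pm.linear_lin_ext)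

lemma
  shows perm_act_0 [simp]: "perm_act \<sigma> 0 = 0"
    and perm_act_add: "perm_act \<sigma> (p + q) = perm_act \<sigma> p + perm_act \<sigma> q"
  by (simp_all add: perm_act_def pm.lin_ext_add)

lemma perm_act_single [simp]:
  "perm_act \<sigma> (Poly_Mapping.single (NCWord xs) c)
    = Poly_Mapping.single (NCWord (map (\<lambda>(j, h). (\<sigma> j, h)) xs)) c"
  by (simp add: perm_act_def)

lemma perm_act_rev_poly: "perm_act \<sigma> (rev_poly f) = rev_poly (perm_act \<sigma> f)"
  using subset_UNIV
proof (induction f rule: keys_induct)
  case (single w c)
  show ?case by (cases w) (simp add: rev_map)
qed (simp_all add: rev_poly_add perm_act_add)

lemma (in L_algebra) diff_subst_perm_act:
  "diff_subst A \<phi> (perm_act \<sigma> f) = diff_subst A (\<lambda>j. \<phi> (\<sigma> j)) f"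
  using subset_UNIV
proof (induction f rule: keys_induct)
  case (single w c)
  show ?case by (cases w) (simp add: word_val_def o_def case_prod_unfold)
qed (simp_all add: perm_act_add diff_subst_add)

definition multilin_word :: "nat \<Rightarrow> (nat \<Rightarrow> nat) \<Rightarrow> (nat \<Rightarrow> 'f poly) \<Rightarrow> (nat \<times> 'f::field_char_0 poly) list" where
  "multilin_word n \<sigma> h = map (\<lambda>i. (\<sigma> i, h i)) [0..<n]"

lemma multilin_eq:
  "multilin B n = pm.span {wd (multilin_word n \<sigma> h) | \<sigma> h. \<sigma> permutes {..<n} \<and> (\<forall>i<n. h i \<in> B)}"
  by (simp add: multilin_def multilin_word_def)

lemma multilin_wordI:
  "\<lbrakk>\<sigma> permutes {..<n}; \<And>i. i < n \<Longrightarrow> h i \<in> B\<rbrakk> \<Longrightarrow> wd (multilin_word n \<sigma> h) \<in> multilin B n"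
  unfolding multilin_eq by (rule pm.span_base) blast

lemma subspace_multilin: "pm.subspace (multilin B n)"
  unfolding multilin_eq by (rule pm.subspace_span)

lemma multilin_induct [consumes 1, case_names zero step]:
  assumes "f \<in> multilin B n" "P 0"
    "\<And>c \<sigma> h g. \<lbrakk>\<sigma> permutes {..<n}; \<forall>i<n. h i \<in> B; P g\<rbrakk>
        \<Longrightarrow> P (pm_scale c (wd (multilin_word n \<sigma> h)) + g)"
  shows "P f"
  using assms(1) unfolding multilin_eq
proof (induction rule: pm.span_induct_alt)
  case (step c x g)
  then show ?case using assms(3) by blast
qed (rule assms(2))

lemma multilin_linear_image:
  assumes T: "Vector_Spaces.linear pm_scale pm_scale T"
    and word: "\<And>\<sigma> h. \<lbrakk>\<sigma> permutes {..<n}; \<forall>i<n. h i \<in> B\<rbrakk> \<Longrightarrow> T (wd (multilin_word n \<sigma> h)) \<in> multilin B n"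
    and f: "f \<in> multilin B n"
  shows "T f \<in> multilin B n"
proof -
  interpret T: Vector_Spaces.linear pm_scale pm_scale T by fact
  from f show ?thesis
  proof (induction rule: multilin_induct)
    case (step c \<sigma> h g)
    have "T (pm_scale c (wd (multilin_word n \<sigma> h)) + g) = pm_scale c (T (wd (multilin_word n \<sigma> h))) + T g"
      by (simp only: T.add T.scale)
    with step word show ?case
      using subspace_multilin by (metis pm.subspace_add pm.subspace_scale)
  qed (simp add: T.zero pm.subspace_0 subspace_multilin)
qed

lemma perm_act_multilin:
  assumes \<rho>: "\<rho> permutes {..<n}" and f: "f \<in> multilin B n"
  shows "perm_act \<rho> f \<in> multilin B n"
proof (rule multilin_linear_image[OF linear_perm_act _ f])
  fix \<sigma> h assume "\<sigma> permutes {..<n}" "\<forall>i<n. h i \<in> B"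
  then show "perm_act \<rho> (wd (multilin_word n \<sigma> h)) \<in> multilin B n"
    using multilin_wordI[of "\<rho> \<circ> \<sigma>" n h B] permutes_compose[OF _ \<rho>]
    by (simp add: multilin_word_def o_def)
qed

lemma rev_poly_multilin:
  assumes f: "f \<in> multilin B n"
  shows "rev_poly f \<in> multilin B n"
proof (rule multilin_linear_image[OF linear_rev_poly _ f])
  fix \<sigma> h assume \<sigma>: "\<sigma> permutes {..<n}" and h: "\<forall>i<n. h i \<in> B"
  define r where "r i = (if i < n then n - Suc i else i)" for i
  have "bij_betw r {..<n} {..<n}"
    by (rule bij_betw_byWitness[where f' = r]) (auto simp: r_def)
  then have r: "r permutes {..<n}"
    by (rule bij_imp_permutes) (simp add: r_def)
  have "rev (multilin_word n \<sigma> h) = multilin_word n (\<sigma> \<circ> r) (h \<circ> r)"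
    by (rule nth_equalityI) (simp_all add: multilin_word_def rev_nth r_def)
  then show "rev_poly (wd (multilin_word n \<sigma> h)) \<in> multilin B n"
    using multilin_wordI[OF permutes_compose[OF r \<sigma>], of "h \<circ> r" B] h
    by (simp add: r_def)
qed

lemma multilin_carr:
  assumes n: "n \<ge> 1"
  shows "multilin B n \<subseteq> carr (free_L_alg B)"
  unfolding multilin_eq
proof (rule pm.span_minimal[OF _ subspace_free_carr])
  show "{wd (multilin_word n \<sigma> h) | \<sigma> h. \<sigma> permutes {..<n} \<and> (\<forall>i<n. h i \<in> B)} \<subseteq> carr (free_L_alg B)"
    using n by (auto simp: multilin_word_def intro!: wd_closed)
qed

text \<open>
  At \<open>test_point i\<close> the variable \<open>x\<^sub>i\<close> is \<open>e\<^sub>1\<^sub>2\<close> and all others are \<open>e\<^sub>2\<^sub>2\<close>. On multilinear polynomials of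
  degree n in the first n variables, the \<open>e\<^sub>1\<^sub>2\<close>-coordinate of the value there is the coefficient of the normal form
  \<open>x\<^sub>i \<dots>\<close> if \<open>i < n\<close>; if \<open>i = n\<close>, all the variables that occur are \<open>e\<^sub>2\<^sub>2\<close>, and it is the coefficient of the
  normal form that begins with a derivative.
\<close>

definition test_point :: "nat \<Rightarrow> nat \<Rightarrow> 'f::field_char_0^2^2" where
  "test_point i j = (if j = i then mat_unit 1 2 else mat_unit 2 2)"

definition test_coeff :: "nat \<Rightarrow> 'f::field_char_0 diff_poly \<Rightarrow> 'f" where
  "test_coeff i f = diff_subst M1_delta (test_point i) f $ 1 $ 2"

lemma test_point_entries:
  "test_point i j $ 2 $ 2 = (if j = i then 0 else 1)"
  "test_point i j $ 1 $ 2 = (if j = i then 1 else 0)"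
  by (simp_all add: test_point_def mat_unit_def)

lemma test_point_M1: "\<forall>j. test_point i j \<in> carr M1_delta"
  by (simp add: test_point_def mem_M1_delta mat_unit_def)

lemma
  shows test_coeff_0 [simp]: "test_coeff i 0 = 0"
    and test_coeff_add: "test_coeff i (p + q) = test_coeff i p + test_coeff i q"
    and test_coeff_diff: "test_coeff i (p - q) = test_coeff i p - test_coeff i q"
    and test_coeff_scale: "test_coeff i (pm_scale c p) = c * test_coeff i p"
    and test_coeff_sum: "test_coeff i (\<Sum>j\<in>S. r j) = (\<Sum>j\<in>S. test_coeff i (r j))"
  by (simp_all add: test_coeff_def M1.diff_subst_add M1.diff_subst_diff M1.diff_subst_scale
      M1.diff_subst_sum M1_simps mat_scale_def)

lemma linear_test_coeff: "Vector_Spaces.linear pm_scale (*) (test_coeff i)"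
  by unfold_locales (simp_all add: test_coeff_add test_coeff_scale algebra_simps)

text \<open>
  Permuting the variables permutes the test points. A permutation of \<open>{..<n}\<close> fixes n, so the last
  test coefficient is invariant.
\<close>

lemma test_coeff_perm_act:
  fixes f :: "'f::field_char_0 diff_poly"
  assumes "\<sigma> permutes S"
  shows "test_coeff i (perm_act \<sigma> f) = test_coeff (inv \<sigma> i) f"
proof -
  have "\<sigma> j = i \<longleftrightarrow> j = inv \<sigma> i" for j
    using permutes_inverses[OF assms] by metis
  then have "(\<lambda>j. test_point i (\<sigma> j)) = (test_point (inv \<sigma> i) :: nat \<Rightarrow> 'f^2^2)"
    unfolding test_point_def by (simp add: fun_eq_iff)
  then show ?thesis
    unfolding test_coeff_def M1.diff_subst_perm_act by simp
qed

lemma multilin_word_eval: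
  fixes \<phi> :: "nat \<Rightarrow> 'f::field_char_0^2^2"
  assumes n: "n \<ge> 1" and \<sigma>: "\<sigma> permutes {..<n}" and \<phi>: "\<forall>j. \<phi> j \<in> carr M1_delta"
  shows "word_val M1_delta \<phi> (multilin_word n \<sigma> h)
    = mat_scale ((\<Prod>k\<in>{1..<n}. coeff (h k) 0) * (\<Prod>j\<in>{..<n} - {\<sigma> 0}. \<phi> j $ 2 $ 2))
       (mat_scale (coeff (h 0) 0) (\<phi> (\<sigma> 0))
        + mat_scale (coeff (h 0) 1 * \<phi> (\<sigma> 0) $ 2 $ 2) (mat_unit 1 2))"
proof -
  have w: "multilin_word n \<sigma> h = (\<sigma> 0, h 0) # map (\<lambda>i. (\<sigma> i, h i)) [1..<n]"
    using n by (simp add: multilin_word_def upt_conv_Cons)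
  have "{1..<n} = {..<n} - {0}" by auto
  moreover have "bij_betw \<sigma> ({..<n} - {0}) ({..<n} - {\<sigma> 0})"
    using n permutes_imp_bij[OF \<sigma>] permutes_inj[OF \<sigma>]
    by (intro bij_betw_DiffI) (auto simp: bij_betw_def)
  ultimately have "(\<Prod>k\<in>{1..<n}. \<phi> (\<sigma> k) $ 2 $ 2) = (\<Prod>j\<in>{..<n} - {\<sigma> 0}. \<phi> j $ 2 $ 2)"
    using prod.reindex_bij_betw[of \<sigma> _ _ "\<lambda>j. \<phi> j $ 2 $ 2"] by simp
  moreover have "(\<Prod>k\<leftarrow>[1..<n]. g k) = (\<Prod>k\<in>{1..<n}. g k)" for g :: "nat \<Rightarrow> 'f"
    using prod.distinct_set_conv_list[of "[1..<n]" g] by simp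
  ultimately show ?thesis
    unfolding w M1_word_val[OF \<phi>] by (simp add: o_def)
qed

lemma test_coeff_multilin_word:
  assumes n: "n \<ge> 1" and \<sigma>: "\<sigma> permutes {..<n}" and i: "i \<le> n"
  shows "test_coeff i (wd (multilin_word n \<sigma> h))
    = (\<Prod>k\<in>{1..<n}. coeff (h k) 0) *
      (if i = n then coeff (h 0) 1 else if i = \<sigma> 0 then coeff (h 0) 0 else 0)"
proof -
  have \<sigma>0: "\<sigma> 0 < n" using n permutes_in_image[OF \<sigma>, of 0] by simp
  have "(\<Prod>j\<in>{..<n} - {\<sigma> 0}. if j = i then 0 else 1 :: 'a) = (if i = n \<or> i = \<sigma> 0 then 1 else 0)"
    using i \<sigma>0 by (auto intro!: prod.neutral prod_zero bexI[of _ i])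
  then show ?thesis
    using \<sigma>0
    unfolding test_coeff_def M1.diff_subst_single multilin_word_eval[OF n \<sigma> test_point_M1]
    by (auto simp: test_point_entries M1_simps mat_scale_def mat_unit_def)
qed

text \<open>
  The n + 1 test coefficients determine all values of a multilinear polynomial in \<open>M\<^sub>1\<close>, so together
  they decide whether it is an identity.
\<close>

lemma multilin_eval:
  fixes \<phi> :: "nat \<Rightarrow> 'f::field_char_0^2^2"
  assumes n: "n \<ge> 1" and \<phi>: "\<forall>j. \<phi> j \<in> carr M1_delta" and f: "f \<in> multilin B n"
  shows "diff_subst M1_delta \<phi> f
    = (\<Sum>i<n. mat_scale (test_coeff i f * (\<Prod>j\<in>{..<n} - {i}. \<phi> j $ 2 $ 2)) (\<phi> i))
      + mat_scale (test_coeff n f * (\<Prod>j<n. \<phi> j $ 2 $ 2)) (mat_unit 1 2)"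
  using f
proof (induction rule: multilin_induct)
  case (step c \<sigma> h g)
  let ?w = "multilin_word n \<sigma> h"
  let ?k = "\<Prod>k\<in>{1..<n}. coeff (h k) 0"
  have \<sigma>0: "\<sigma> 0 < n" using n permutes_in_image[OF step(1), of 0] by simp
  have "(\<Sum>i<n. mat_scale (test_coeff i (wd ?w) * (\<Prod>j\<in>{..<n} - {i}. \<phi> j $ 2 $ 2)) (\<phi> i))
      = (\<Sum>i<n. if i = \<sigma> 0 then mat_scale (?k * coeff (h 0) 0 * (\<Prod>j\<in>{..<n} - {i}. \<phi> j $ 2 $ 2)) (\<phi> i) else 0)"
    by (rule sum.cong) (auto simp: test_coeff_multilin_word[OF n step(1)])
  also have "\<dots> = mat_scale (?k * coeff (h 0) 0 * (\<Prod>j\<in>{..<n} - {\<sigma> 0}. \<phi> j $ 2 $ 2)) (\<phi> (\<sigma> 0))"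
    using \<sigma>0 by simp
  finally have "word_val M1_delta \<phi> ?w
      = (\<Sum>i<n. mat_scale (test_coeff i (wd ?w) * (\<Prod>j\<in>{..<n} - {i}. \<phi> j $ 2 $ 2)) (\<phi> i))
        + mat_scale (test_coeff n (wd ?w) * (\<Prod>j<n. \<phi> j $ 2 $ 2)) (mat_unit 1 2)"
    unfolding multilin_word_eval[OF n step(1) \<phi>]
    using \<sigma>0 prod.remove[of "{..<n}" "\<sigma> 0" "\<lambda>j. \<phi> j $ 2 $ 2"]
    by (simp add: test_coeff_multilin_word[OF n step(1)] mt.scale_right_distrib mult_ac)
  then have w: "diff_subst M1_delta \<phi> (wd ?w)
      = (\<Sum>i<n. mat_scale (test_coeff i (wd ?w) * (\<Prod>j\<in>{..<n} - {i}. \<phi> j $ 2 $ 2)) (\<phi> i))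
        + mat_scale (test_coeff n (wd ?w) * (\<Prod>j<n. \<phi> j $ 2 $ 2)) (mat_unit 1 2)"
    by (simp add: M1_simps)
  show ?case
    unfolding M1.diff_subst_add M1.diff_subst_scale w step M1_simps test_coeff_add test_coeff_scale
    by (simp add: mt.scale_right_distrib mt.scale_left_distrib distrib_right sum.distrib
        mt.scale_sum_right mult.assoc)
qed simp

text \<open>
  Multilinear representatives of the n + 1 normal forms. The last one, \<open>x\<^sub>0\<^sup>\<delta> x\<^sub>1 x\<^sub>2 \<dots>\<close>, need not be a
  single word, since \<open>\<delta>\<close> need not belong to B.
\<close>

definition dual_poly :: "'f::field_char_0 poly set \<Rightarrow> nat \<Rightarrow> nat \<Rightarrow> 'f diff_poly" where
  "dual_poly B n i =
    (if i < n then wd (multilin_word n (Transposition.transpose 0 i) (\<lambda>_. 1))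
     else dvar B 0 delta * wd (map (\<lambda>k. (k, 1)) [1..<n]))"

context
  fixes B :: "'f::field_char_0 poly set" and n :: nat
  assumes B: "U_basis B" and n: "n \<ge> 1"
begin

lemma dual_poly_last:
  "dual_poly B n n = (\<Sum>b | pl.representation B delta b \<noteq> 0.
     pm_scale (pl.representation B delta b) (wd (multilin_word n id (\<lambda>k. if k = 0 then b else 1))))"
proof -
  have "multilin_word n id (\<lambda>k. if k = 0 then b else 1) = (0, b) # map (\<lambda>k. (k, 1)) [1..<n]" for b :: "'f poly"
    using n by (simp add: multilin_word_def upt_conv_Cons)
  then show ?thesis
    by (simp add: dual_poly_def dvar_def sum_distrib_right mult_single)
qed

lemma dual_poly_multilin: "i \<le> n \<Longrightarrow> dual_poly B n i \<in> multilin B n"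
proof (cases "i = n")
  case True
  have "1 \<in> B" using B by (simp add: U_basis_def)
  then show ?thesis
    unfolding True dual_poly_last
    by (intro pm.subspace_sum pm.subspace_scale subspace_multilin multilin_wordI permutes_id)
      (auto dest: pl.representation_ne_zero)
next
  case False
  moreover assume "i \<le> n"
  ultimately show ?thesis
    using n B by (auto simp: dual_poly_def U_basis_def intro!: multilin_wordI permutes_swap_id)
qed

lemma test_coeff_dual_poly:
  assumes i: "i \<le> n" and j: "j \<le> n"
  shows "test_coeff i (dual_poly B n j) = (if i = j then 1 else 0)"
proof (cases "j = n")
  case True
  let ?r = "pl.representation B delta"
  have "(\<Sum>b | ?r b \<noteq> 0. smult (?r b) b) = delta"
    using B by (intro pl.sum_nonzero_representation_eq) (auto simp: U_basis_def)
  then have c: "(\<Sum>b | ?r b \<noteq> 0. ?r b * coeff b k) = coeff delta k" for k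
    by (metis (no_types, lifting) coeff_smult coeff_sum sum.cong)
  have "test_coeff i (dual_poly B n n)
      = (\<Sum>b | ?r b \<noteq> 0. ?r b * (if i = n then coeff b 1 else if i = 0 then coeff b 0 else 0))"
    unfolding dual_poly_last test_coeff_sum test_coeff_scale
    by (simp add: test_coeff_multilin_word[OF n permutes_id i] cong: if_cong)
  also have "\<dots> = (if i = n then 1 else 0)"
    using c[of 0] c[of 1] by (cases "i = n"; cases "i = 0") simp_all
  finally show ?thesis using True by simp
next
  case False
  then have j: "j < n" using j by simp
  then have "Transposition.transpose 0 j permutes {..<n}" by (intro permutes_swap_id) auto
  from test_coeff_multilin_word[OF n this i, of "\<lambda>_. 1 :: 'f poly"] show ?thesis
    using j by (auto simp: dual_poly_def)
qed

text \<open>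
  The test coefficients and the dual polynomials, transported along r, form a pair of dual bases. The
  involution r is the identity for \<open>M\<^sub>1\<close> and the reversal of words for \<open>M\<^sub>2\<close>.
\<close>

lemma codim_cochar_via_involution:
  assumes r: "Vector_Spaces.linear pm_scale pm_scale r"
    and rV: "\<And>f. f \<in> multilin B n \<Longrightarrow> r f \<in> multilin B n"
    and rr: "\<And>f. r (r f) = f"
    and rp: "\<And>\<sigma> f. perm_act \<sigma> (r f) = r (perm_act \<sigma> f)"
    and A: "\<And>f. f \<in> diff_Id B A \<longleftrightarrow> r f \<in> diff_Id B (M1_delta :: ('f, 'f^2^2) L_alg)"
  shows "diff_codim B A n = n + 1"
    and "\<sigma> permutes {..<n} \<Longrightarrow> diff_cochar B A n \<sigma> = of_nat (card {i. i < n \<and> \<sigma> i = i}) + 1"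
proof -
  interpret r: Vector_Spaces.linear pm_scale pm_scale r by fact
  let ?V = "multilin B n" and ?W = "multilin B n \<inter> diff_Id B A"
  let ?M = "M1_delta :: ('f, 'f^2^2) L_alg"
  have W: "f \<in> ?W \<longleftrightarrow> f \<in> ?V \<and> r f \<in> diff_Id B ?M" for f by (simp add: A)
  have IdI: "f \<in> diff_Id B ?M" if f: "f \<in> ?V" and "\<And>i. i \<le> n \<Longrightarrow> test_coeff i f = 0" for f
    using that multilin_carr[OF n, of B] by (auto simp: diff_Id_def multilin_eval[OF n _ f])
  have IdD: "test_coeff i f = 0" if "f \<in> diff_Id B ?M" for f i
    using that by (simp add: diff_Id_def test_coeff_def test_point_M1)
  have subW: "pm.subspace ?W"
    using TL_ideal_diff_Id[OF B M1_delta_L_algebra] subspace_multilin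
    by (intro pm.subspaceI)
      (auto simp: A r.add r.scale r.zero TL_ideal_def pm.subspace_def)
  have main: "quot_dim pm_scale ?V ?W = Suc n"
    "quot_trace pm_scale ?V ?W (perm_act \<sigma>)
      = (\<Sum>i<Suc n. test_coeff i (r (perm_act \<sigma> (r (dual_poly B n i)))))"
    if \<sigma>: "\<sigma> permutes {..<n}" for \<sigma>
  proof -
    have gen: "u - (\<Sum>i<Suc n. pm_scale (test_coeff i (r u)) (r (dual_poly B n i))) \<in> ?W" if u: "u \<in> ?V" for u
    proof -
      let ?d = "u - (\<Sum>i<Suc n. pm_scale (test_coeff i (r u)) (r (dual_poly B n i)))"
      have V: "?d \<in> ?V"
        by (intro pm.subspace_diff pm.subspace_sum pm.subspace_scale subspace_multilin u rV dual_poly_multilin) auto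
      have "r ?d = r u - (\<Sum>i<Suc n. pm_scale (test_coeff i (r u)) (dual_poly B n i))"
        by (simp only: r.diff r.sum r.scale rr)
      moreover have "(\<Sum>j<Suc n. test_coeff j (r u) * test_coeff i (dual_poly B n j)) = test_coeff i (r u)"
        if "i \<le> n" for i
      proof -
        have "(\<Sum>j<Suc n. test_coeff j (r u) * test_coeff i (dual_poly B n j))
            = (\<Sum>j<Suc n. if i = j then test_coeff j (r u) else 0)"
          using that by (intro sum.cong) (auto simp: test_coeff_dual_poly)
        then show ?thesis using that by (simp del: sum.lessThan_Suc)
      qed
      ultimately have "test_coeff i (r ?d) = 0" if "i \<le> n" for i
        using that by (simp only: test_coeff_diff test_coeff_sum test_coeff_scale) simp
      then show ?thesis using V IdI[OF rV[OF V]] by (simp only: W)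
    qed
    have l: "Vector_Spaces.linear pm_scale (*) (\<lambda>f. test_coeff i (r f))" for i
      using Vector_Spaces.linear_compose[OF r linear_test_coeff] by (simp add: o_def)
    have TW: "perm_act \<sigma> u \<in> ?W" if "u \<in> ?W" for u
    proof -
      from that have u: "u \<in> ?V" "r u \<in> diff_Id B ?M" unfolding W by auto
      then have "perm_act \<sigma> (r u) \<in> diff_Id B ?M"
        using perm_act_multilin[OF \<sigma> rV] multilin_carr[OF n, of B]
        by (auto simp: diff_Id_def M1.diff_subst_perm_act)
      then show ?thesis
        unfolding W rp using perm_act_multilin[OF \<sigma> u(1)] by simp
    qed
    note * = quot_dim_trace[OF pm.vector_space_axioms subspace_multilin subW _ l _ _ gen linear_perm_act _ TW]
    show "quot_dim pm_scale ?V ?W = Suc n"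
      by (rule *(1)) (auto simp: rr A IdD rV dual_poly_multilin test_coeff_dual_poly perm_act_multilin[OF \<sigma>])
    show "quot_trace pm_scale ?V ?W (perm_act \<sigma>)
      = (\<Sum>i<Suc n. test_coeff i (r (perm_act \<sigma> (r (dual_poly B n i)))))"
      by (rule *(2)) (auto simp: rr A IdD rV dual_poly_multilin test_coeff_dual_poly perm_act_multilin[OF \<sigma>])
  qed
  show "diff_codim B A n = n + 1"
    using main(1)[OF permutes_id] by (simp add: diff_codim_def)
  assume \<sigma>: "\<sigma> permutes {..<n}"
  have "(\<Sum>i<Suc n. test_coeff i (r (perm_act \<sigma> (r (dual_poly B n i)))))
      = (\<Sum>i<Suc n. if \<sigma> i = i then 1 else 0)"
  proof (rule sum.cong)
    fix i assume "i \<in> {..<Suc n}"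
    then have i: "i \<le> n" by simp
    have "inv \<sigma> i \<le> n"
      using i permutes_in_image[OF permutes_inv[OF \<sigma>], of i] permutes_not_in[OF permutes_inv[OF \<sigma>], of i]
      by (cases "i < n") auto
    then have "test_coeff i (perm_act \<sigma> (dual_poly B n i)) = (if inv \<sigma> i = i then 1 else 0)"
      using i by (simp add: test_coeff_perm_act[OF \<sigma>] test_coeff_dual_poly)
    moreover have "inv \<sigma> i = i \<longleftrightarrow> \<sigma> i = i"
      by (metis permutes_inverses[OF \<sigma>])
    ultimately show "test_coeff i (r (perm_act \<sigma> (r (dual_poly B n i)))) = (if \<sigma> i = i then 1 else 0)"
      by (simp add: rp rr)
  qed simp
  also have "\<dots> = (\<Sum>i<n. if \<sigma> i = i then 1 else 0) + 1"
    using permutes_not_in[OF \<sigma>, of n] by simp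
  also have "(\<Sum>i<n. if \<sigma> i = i then 1 else 0 :: 'f) = of_nat (card {i. i < n \<and> \<sigma> i = i})"
    by (simp add: sum.If_cases lessThan_def Int_def)
  finally show "diff_cochar B A n \<sigma> = of_nat (card {i. i < n \<and> \<sigma> i = i}) + 1"
    using main(2)[OF \<sigma>] by (simp add: diff_cochar_def)
qed

lemma codim_cochar_M1:
  shows "diff_codim B (M1_delta :: ('f, 'f^2^2) L_alg) n = n + 1"
    and "\<sigma> permutes {..<n} \<Longrightarrow> diff_cochar B (M1_delta :: ('f, 'f^2^2) L_alg) n \<sigma>
      = of_nat (card {i. i < n \<and> \<sigma> i = i}) + 1"
  by (rule codim_cochar_via_involution[OF pm.linear_ident _ refl refl refl]; assumption)+

lemma codim_cochar_M2:
  shows "diff_codim B (M2_delta :: ('f, 'f^2^2) L_alg) n = n + 1"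
    and "\<sigma> permutes {..<n} \<Longrightarrow> diff_cochar B (M2_delta :: ('f, 'f^2^2) L_alg) n \<sigma>
      = of_nat (card {i. i < n \<and> \<sigma> i = i}) + 1"
  by (rule codim_cochar_via_involution[OF linear_rev_poly rev_poly_multilin rev_poly_rev_poly
        perm_act_rev_poly diff_Id_M2_iff]; assumption)+

end

section \<open>Two irreducible characters of the symmetric group\<close>

lemma linear_left_mult: "Vector_Spaces.linear pm_scale pm_scale (left_mult \<rho>)"
  unfolding left_mult_def by (rule pm.linear_lin_ext)

lemma linear_lookup: "Vector_Spaces.linear pm_scale (*) (\<lambda>p. Poly_Mapping.lookup p \<pi>)"
  by unfold_locales (simp_all add: lookup_add algebra_simps)

lemma left_mult_irr_module:
  assumes \<rho>: "\<rho> permutes {..<sum_list lam}" and f: "f \<in> irr_module lam"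
  shows "left_mult \<rho> f \<in> irr_module lam"
proof -
  interpret l: Vector_Spaces.linear pm_scale pm_scale "left_mult \<rho> :: _ \<Rightarrow> (nat \<Rightarrow> nat) \<Rightarrow>\<^sub>0 'a"
    by (rule linear_left_mult)
  have comp: "left_mult \<rho> (left_mult \<pi> p) = left_mult (\<rho> \<circ> \<pi>) p" for \<pi> and p :: "(nat \<Rightarrow> nat) \<Rightarrow>\<^sub>0 'a"
    using subset_UNIV
  proof (induction p rule: keys_induct)
    case (add p q)
    then show ?case by (simp add: left_mult_def pm.lin_ext_add)
  qed (simp_all add: left_mult_def comp_def)
  from f show ?thesis
    unfolding irr_module_def
  proof (induction rule: pm.span_induct_alt)
    case (step c x g)
    then obtain \<pi> where \<pi>: "\<pi> permutes {..<sum_list lam}" and x: "x = left_mult \<pi> (young_symmetrizer lam)"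
      by blast
    have "left_mult \<rho> x \<in> pm.span {left_mult \<rho> (young_symmetrizer lam) | \<rho>. \<rho> permutes {..<sum_list lam}}"
      unfolding x comp using permutes_compose[OF \<pi> \<rho>] by (intro pm.span_base) blast
    then show ?case
      using step by (simp add: l.add l.scale pm.span_add pm.span_scale)
  qed (simp add: l.zero pm.span_zero)
qed

text \<open>
  Dual bases of the module whose functionals are coefficients at suitable permutations. Expanding the
  translates of the Young symmetrizer is enough, as they span the module.
\<close>

lemma irr_char_eq:
  fixes v :: "nat \<Rightarrow> (nat \<Rightarrow> nat) \<Rightarrow>\<^sub>0 'f::field_char_0"
  assumes v: "\<And>i. i < m \<Longrightarrow> v i \<in> irr_module lam"
    and dual: "\<And>i j. \<lbrakk>i < m; j < m\<rbrakk> \<Longrightarrow> Poly_Mapping.lookup (v j) (\<pi> i) = (if i = j then 1 else 0)"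
    and gen: "\<And>\<rho>. \<rho> permutes {..<sum_list lam} \<Longrightarrow>
      left_mult \<rho> (young_symmetrizer lam) = (\<Sum>i<m. pm_scale
        (Poly_Mapping.lookup (left_mult \<rho> (young_symmetrizer lam)) (\<pi> i)) (v i))"
    and \<sigma>: "\<sigma> permutes {..<sum_list lam}"
  shows "irr_char lam \<sigma> = (\<Sum>i<m. Poly_Mapping.lookup (left_mult \<sigma> (v i)) (\<pi> i))"
  unfolding irr_char_def
proof (rule quot_dim_trace(2)[OF pm.vector_space_axioms _ _ v linear_lookup dual _ _ linear_left_mult])
  interpret l: Vector_Spaces.linear pm_scale pm_scale "left_mult \<sigma> :: _ \<Rightarrow> (nat \<Rightarrow> nat) \<Rightarrow>\<^sub>0 'f"
    by (rule linear_left_mult)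
  show "pm.subspace (irr_module lam :: ((nat \<Rightarrow> nat) \<Rightarrow>\<^sub>0 'f) set)"
    unfolding irr_module_def by (rule pm.subspace_span)
  show "left_mult \<sigma> u \<in> {0}" if "u \<in> {0}" for u :: "(nat \<Rightarrow> nat) \<Rightarrow>\<^sub>0 'f"
    using that by (simp add: l.zero)
  fix u :: "(nat \<Rightarrow> nat) \<Rightarrow>\<^sub>0 'f" assume u: "u \<in> irr_module lam"
  then show "left_mult \<sigma> u \<in> irr_module lam" by (rule left_mult_irr_module[OF \<sigma>])
  from u have "u = (\<Sum>i<m. pm_scale (Poly_Mapping.lookup u (\<pi> i)) (v i))"
    unfolding irr_module_def
  proof (induction rule: pm.span_induct_alt)
    case (step c x g)
    then obtain \<rho> where \<rho>: "\<rho> permutes {..<sum_list lam}" and x: "x = left_mult \<rho> (young_symmetrizer lam)"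
      by blast
    have "pm_scale c x + g = pm_scale c (\<Sum>i<m. pm_scale (Poly_Mapping.lookup x (\<pi> i)) (v i))
        + (\<Sum>i<m. pm_scale (Poly_Mapping.lookup g (\<pi> i)) (v i))"
      using gen[OF \<rho>] step by (simp flip: x)
    also have "\<dots> = (\<Sum>i<m. pm_scale (Poly_Mapping.lookup (pm_scale c x + g) (\<pi> i)) (v i))"
      by (simp add: lookup_add pm.scale_sum_right pm.scale_left_distrib sum.distrib)
    finally show ?case .
  qed simp
  then show "u - (\<Sum>i<m. pm_scale (Poly_Mapping.lookup u (\<pi> i)) (v i)) \<in> {0}" by simp
qed (auto simp: pm.subspace_def)

text \<open>
  For a single row the Young symmetrizer is the sum of all permutations, which spans an invariant line.
\<close>

lemma irr_char_trivial:
  assumes \<sigma>: "\<sigma> permutes {..<n}"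
  shows "irr_char [n] \<sigma> = (1 :: 'f::field_char_0)"
proof -
  let ?e = "young_symmetrizer [n] :: (nat \<Rightarrow> nat) \<Rightarrow>\<^sub>0 'f"
  have row: "tab_row [n] m = 0" if "m < n" for m
    unfolding tab_row_def using that by (intro Least_equality) auto
  then have col: "tab_col [n] m = m" if "m < n" for m
    using that by (simp add: tab_col_def)
  have "\<tau> = id" if "\<tau> permutes {..<n}" "\<forall>m<n. tab_col [n] (\<tau> m) = tab_col [n] m" for \<tau>
  proof
    fix m show "\<tau> m = id m"
      using that col permutes_in_image[OF that(1), of m] permutes_not_in[OF that(1), of m]
      by (cases "m < n") auto
  qed
  then have "col_stab [n] = {id}"
    by (auto simp: col_stab_def permutes_id)
  moreover have "row_stab [n] = {\<sigma>. \<sigma> permutes {..<n}}"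
    using row permutes_in_image by (fastforce simp: row_stab_def)
  ultimately have e: "?e = (\<Sum>\<pi> | \<pi> permutes {..<n}. Poly_Mapping.single \<pi> 1)"
    by (simp add: young_symmetrizer_def)
  have inv: "left_mult \<rho> ?e = ?e" if \<rho>: "\<rho> permutes {..<n}" for \<rho>
  proof -
    have "left_mult \<rho> ?e = (\<Sum>\<pi> | \<pi> permutes {..<n}. Poly_Mapping.single (\<rho> \<circ> \<pi>) 1)"
      unfolding e by (simp add: left_mult_def pm.lin_ext_sum)
    also have "\<dots> = ?e"
      unfolding e by (rule setum_permutations_compose_left[OF \<rho>, symmetric])
    finally show ?thesis .
  qed
  have one: "Poly_Mapping.lookup ?e id = 1"
    by (simp add: e lookup_sum lookup_single when_def finite_permutations permutes_id cong: if_cong)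
  have mem: "?e \<in> irr_module [n]"
    unfolding irr_module_def using inv[OF permutes_id]
    by (intro pm.span_base CollectI exI[of _ id]) (simp add: permutes_id)
  have "irr_char [n] \<sigma> = (\<Sum>i<(1::nat). Poly_Mapping.lookup (left_mult \<sigma> ?e) id)"
    by (rule irr_char_eq) (use \<sigma> in \<open>simp_all add: mem inv one\<close>)
  then show ?thesis by (simp add: inv[OF \<sigma>] one)
qed

text \<open>
  The row stabilizer is the stabilizer of n - 1, and the column stabilizer is generated by the
  transposition t of 0 and n - 1. The translate of the Young symmetrizer by \<open>\<rho>\<close> is the sum of the
  permutations that map n - 1 to k, minus the sum of those that map 0 to k, where \<open>k = \<rho> (n - 1)\<close>.
  These n vectors are permuted like the values of k, add up to zero, and all but the last one are
  linearly independent.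
\<close>

lemma irr_char_standard:
  assumes n: "n \<ge> 2" and \<sigma>: "\<sigma> permutes {..<n}"
  shows "irr_char [n - 1, 1] \<sigma> = (of_nat (card {i. i < n \<and> \<sigma> i = i}) - 1 :: 'f::field_char_0)"
proof -
  define lam where "lam = [n - 1, 1 :: nat]"
  let ?e = "young_symmetrizer lam :: (nat \<Rightarrow> nat) \<Rightarrow>\<^sub>0 'f"
  define t where "t = Transposition.transpose 0 (n - 1)"
  have t: "t permutes {..<n}" unfolding t_def using n by (intro permutes_swap_id) auto
  have tt: "t \<circ> t = id" by (simp add: t_def)
  have size: "sum_list lam = n" using n by (simp add: lam_def)
  have row: "tab_row lam m = (if m = n - 1 then 1 else 0)" if "m < n" for m
  proof (cases "m = n - 1")
    case True
    have "(LEAST r. m < sum_list (take (Suc r) lam)) = 1"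
    proof (rule Least_equality)
      show "m < sum_list (take (Suc 1) lam)" using True n by (simp add: lam_def)
      fix r assume "m < sum_list (take (Suc r) lam)"
      with True show "1 \<le> r" by (cases r) (auto simp: lam_def)
    qed
    with True show ?thesis by (simp add: tab_row_def)
  next
    case False
    then show ?thesis
      unfolding tab_row_def using that by (auto simp: lam_def intro!: Least_equality)
  qed
  then have col: "tab_col lam m = (if m = n - 1 then 0 else m)" if "m < n" for m
    using that by (auto simp: tab_col_def lam_def)
  have "row_stab lam = {\<sigma>. \<sigma> permutes {..<n} \<and> \<sigma> (n - 1) = n - 1}"
  proof -
    have "(\<forall>m<n. tab_row lam (\<sigma> m) = tab_row lam m) \<longleftrightarrow> \<sigma> (n - 1) = n - 1"
      if \<sigma>: "\<sigma> permutes {..<n}" for \<sigma>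
    proof -
      have "tab_row lam (\<sigma> m) = tab_row lam m \<longleftrightarrow> (\<sigma> m = n - 1 \<longleftrightarrow> m = n - 1)" if "m < n" for m
        using row[OF that] row[of "\<sigma> m"] permutes_in_image[OF \<sigma>, of m] that by auto
      then have "(\<forall>m<n. tab_row lam (\<sigma> m) = tab_row lam m) \<longleftrightarrow> (\<forall>m<n. \<sigma> m = n - 1 \<longleftrightarrow> m = n - 1)"
        by blast
      also have "\<dots> \<longleftrightarrow> \<sigma> (n - 1) = n - 1"
        using n injD[OF permutes_inj[OF \<sigma>]] by (metis diff_less less_le_trans zero_less_numeral zero_less_one)
      finally show ?thesis .
    qed
    then show ?thesis by (auto simp: row_stab_def size)
  qed
  moreover have "col_stab lam = {id, t}"
  proof (intro equalityI subsetI)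
    fix \<tau> assume "\<tau> \<in> col_stab lam"
    then have \<tau>: "\<tau> permutes {..<n}" and c: "\<And>m. m < n \<Longrightarrow> tab_col lam (\<tau> m) = tab_col lam m"
      by (auto simp: col_stab_def size)
    have "\<tau> permutes {0, n - 1}"
    proof (rule permutes_superset[OF \<tau>])
      fix m assume m: "m \<in> {..<n} - {0, n - 1}"
      then have "\<tau> m < n" using permutes_in_image[OF \<tau>, of m] by simp
      then show "\<tau> m = m" using c[of m] m by (auto simp: col split: if_splits)
    qed
    then show "\<tau> \<in> {id, t}" by (simp add: permutes_doubleton_iff t_def)
  next
    fix \<tau> assume "\<tau> \<in> {id, t}"
    then have "\<tau> permutes {..<n}" "\<forall>m<n. tab_col lam (\<tau> m) = tab_col lam m"
      using t n permutes_id by (auto simp: col t_def Transposition.transpose_def)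
    then show "\<tau> \<in> col_stab lam" by (simp add: col_stab_def size)
  qed
  moreover have "t \<noteq> id" "sign t = -1"
    using n by (auto simp: t_def sign_swap_id fun_eq_iff Transposition.transpose_def intro!: exI[of _ 0])
  ultimately have e: "?e = (\<Sum>\<pi> | \<pi> permutes {..<n} \<and> \<pi> (n - 1) = n - 1.
      Poly_Mapping.single \<pi> 1 - Poly_Mapping.single (\<pi> \<circ> t) 1)"
    by (simp add: young_symmetrizer_def single_uminus)
  define P where "P k = {\<pi>. \<pi> permutes {..<n} \<and> \<pi> (n - 1) = k}" for k
  define u :: "nat \<Rightarrow> (nat \<Rightarrow> nat) \<Rightarrow>\<^sub>0 'f"
    where "u k = (\<Sum>\<pi>\<in>P k. Poly_Mapping.single \<pi> 1 - Poly_Mapping.single (\<pi> \<circ> t) 1)" for k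
  have finP: "finite (P k)" for k
    unfolding P_def by (rule finite_subset[OF _ finite_permutations[of "{..<n}"]]) auto
  have left_u: "left_mult \<rho> (u k) = u (\<rho> k)" if \<rho>: "\<rho> permutes {..<n}" for \<rho> k
  proof -
    have "left_mult \<rho> (u k)
        = (\<Sum>\<pi>\<in>P k. Poly_Mapping.single (\<rho> \<circ> \<pi>) 1 - Poly_Mapping.single ((\<rho> \<circ> \<pi>) \<circ> t) 1)"
      by (simp add: u_def left_mult_def pm.lin_ext_sum pm.lin_ext_diff o_assoc)
    also have "\<dots> = u (\<rho> k)"
      unfolding u_def
    proof (rule sum.reindex_bij_witness[where i = "\<lambda>\<pi>. inv \<rho> \<circ> \<pi>" and j = "\<lambda>\<pi>. \<rho> \<circ> \<pi>"])
    qed (auto simp: P_def o_assoc permutes_inv_o[OF \<rho>] permutes_inverses[OF \<rho>]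
        intro: permutes_compose \<rho> permutes_inv)
    finally show ?thesis .
  qed
  have lookup_u: "Poly_Mapping.lookup (u k) \<pi>
      = (if \<pi> permutes {..<n} then (if \<pi> (n - 1) = k then 1 else 0) - (if \<pi> 0 = k then 1 else 0) else 0)" for k \<pi>
  proof -
    have "\<pi>' \<circ> t = \<pi> \<longleftrightarrow> \<pi>' = \<pi> \<circ> t" for \<pi>'
      using tt by (metis comp_assoc comp_id)
    then have "Poly_Mapping.lookup (u k) \<pi> = (if \<pi> \<in> P k then 1 else 0) - (if \<pi> \<circ> t \<in> P k then 1 else 0)"
      by (simp add: u_def lookup_sum lookup_minus lookup_single when_def sum_subtractf finP)
    moreover have "\<pi> \<circ> t permutes {..<n} \<longleftrightarrow> \<pi> permutes {..<n}"
      using permutes_compose[OF t] tt by (metis comp_assoc comp_id)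
    ultimately show ?thesis by (simp add: P_def t_def)
  qed
  have last: "u (n - 1) = - (\<Sum>k<n - 1. u k)"
  proof -
    have "(\<Sum>k<n. u k) = 0"
    proof (rule poly_mapping_eqI)
      fix \<pi>
      have "\<pi> 0 < n" "\<pi> (n - 1) < n" if "\<pi> permutes {..<n}"
        using permutes_in_image[OF that] n by auto
      then show "Poly_Mapping.lookup (\<Sum>k<n. u k) \<pi> = Poly_Mapping.lookup 0 \<pi>"
        by (cases "\<pi> permutes {..<n}") (auto simp: lookup_sum lookup_u sum_subtractf)
    qed
    moreover have "n = Suc (n - 1)" using n by simp
    then have "(\<Sum>k<n. u k) = (\<Sum>k<n - 1. u k) + u (n - 1)"
      by (metis sum.lessThan_Suc)
    ultimately show ?thesis by (simp add: eq_neg_iff_add_eq_0 add.commute)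
  qed
  \<comment> \<open>The permutation \<open>q k\<close> maps n - 1 to k and 0 to n - 1, so its coefficient in \<open>u j\<close> vanishes for
    all \<open>j < n - 1\<close> other than k.\<close>
  define q where "q k = Transposition.transpose 0 k \<circ> Transposition.transpose 0 (n - 1)" for k
  have lookup_q: "Poly_Mapping.lookup (u j) (q k) = (if k = j then 1 else 0) - (if j = n - 1 then 1 else 0)"
    if "k < n - 1" for j k
  proof -
    have "q k permutes {..<n}"
      unfolding q_def using that n by (intro permutes_compose permutes_swap_id) auto
    moreover have "q k (n - 1) = k" "q k 0 = n - 1"
      using that by (auto simp: q_def)
    ultimately show ?thesis by (auto simp: lookup_u)
  qed
  have eu: "?e = u (n - 1)" by (simp add: e u_def P_def)
  have mem: "u k \<in> irr_module lam" if "k < n" for k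
  proof -
    let ?\<rho> = "Transposition.transpose (n - 1) k"
    have "?\<rho> permutes {..<n}" using that by (intro permutes_swap_id) auto
    then have "left_mult ?\<rho> ?e \<in> irr_module lam"
      unfolding irr_module_def size by (intro pm.span_base) blast
    moreover have "left_mult ?\<rho> ?e = u k"
      using left_u[OF \<open>?\<rho> permutes {..<n}\<close>] by (simp add: eu)
    ultimately show ?thesis by simp
  qed
  have "irr_char lam \<sigma> = (\<Sum>k<n - 1. Poly_Mapping.lookup (left_mult \<sigma> (u k)) (q k))"
  proof (rule irr_char_eq)
    fix \<rho> assume "\<rho> permutes {..<sum_list lam}"
    then have \<rho>: "\<rho> permutes {..<n}" by (simp only: size)
    have j: "\<rho> (n - 1) < n" using permutes_in_image[OF \<rho>, of "n - 1"] n by simp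
    have "u j = (\<Sum>i<n - 1. pm_scale (Poly_Mapping.lookup (u j) (q i)) (u i))" if "j < n" for j
    proof (cases "j = n - 1")
      case True
      have "(\<Sum>i<n - 1. pm_scale (Poly_Mapping.lookup (u j) (q i)) (u i)) = (\<Sum>i<n - 1. - u i)"
        using True by (intro sum.cong) (auto simp: lookup_q)
      then show ?thesis using True last by (simp add: sum_negf)
    next
      case False
      then have "j < n - 1" using that by linarith
      then have "(\<Sum>i<n - 1. pm_scale (Poly_Mapping.lookup (u j) (q i)) (u i))
          = (\<Sum>i<n - 1. if i = j then u i else 0)"
        by (intro sum.cong) (auto simp: lookup_q)
      then show ?thesis using \<open>j < n - 1\<close> by simp
    qed
    from this[OF j] show "left_mult \<rho> ?e
        = (\<Sum>i<n - 1. pm_scale (Poly_Mapping.lookup (left_mult \<rho> ?e) (q i)) (u i))"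
      by (simp add: eu left_u[OF \<rho>])
  qed (use \<sigma> n mem in \<open>auto simp: lookup_q size\<close>)
  also have "\<dots> = (\<Sum>k<n - 1. (if \<sigma> k = k then 1 else 0) - (if \<sigma> k = n - 1 then 1 else 0))"
    by (intro sum.cong) (auto simp: left_u[OF \<sigma>] lookup_q)
  also have "\<dots> = (\<Sum>k<n. (if \<sigma> k = k then 1 else 0) - (if \<sigma> k = n - 1 then 1 else 0))"
  proof -
    have "{..<n} = insert (n - 1) {..<n - 1}" using n by auto
    then show ?thesis by simp
  qed
  also have "\<dots> = (\<Sum>k<n. if \<sigma> k = k then 1 else 0) - (\<Sum>k<n. if \<sigma> k = n - 1 then 1 else 0)"
    by (rule sum_subtractf)
  also have "(\<Sum>k<n. if \<sigma> k = n - 1 then 1 else 0 :: 'f) = (\<Sum>k<n. if k = n - 1 then 1 else 0)"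
    by (rule sum.reindex_bij_betw[OF permutes_imp_bij[OF \<sigma>]])
  also have "\<dots> = 1" using n by simp
  also have "(\<Sum>k<n. if \<sigma> k = k then 1 else 0 :: 'f) = of_nat (card {i. i < n \<and> \<sigma> i = i})"
    by (simp add: sum.If_cases lessThan_def Int_def)
  finally show ?thesis unfolding lam_def .
qed

section \<open>The theorem\<close>

theorem theorem7:
  fixes B :: "'f::field_char_0 poly set" and x y z :: nat
  assumes "U_basis B" and "distinct [x, y, z]"
  shows
    "diff_Id B (M1_delta :: ('f, 'f^2^2) L_alg) = TL_generated B
       {dvar B x 1 * (dvar B y 1 * dvar B z 1 - dvar B z 1 * dvar B y 1),
        dvar B x delta * dvar B y 1 - dvar B y delta * dvar B x 1,
        dvar B x 1 * dvar B y delta,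
        dvar B x (delta ^ 2)}
     \<and> diff_Id B (M2_delta :: ('f, 'f^2^2) L_alg) = TL_generated B
       {(dvar B x 1 * dvar B y 1 - dvar B y 1 * dvar B x 1) * dvar B z 1,
        dvar B x 1 * dvar B y delta - dvar B y 1 * dvar B x delta,
        dvar B x delta * dvar B y 1,
        dvar B x (delta ^ 2)}
     \<and> (\<forall>n\<ge>1. diff_codim B (M1_delta :: ('f, 'f^2^2) L_alg) n = n + 1
             \<and> diff_codim B (M2_delta :: ('f, 'f^2^2) L_alg) n = n + 1)
     \<and> (\<forall>n\<ge>1. \<forall>\<sigma>. \<sigma> permutes {..<n} \<longrightarrow>
           diff_cochar B (M1_delta :: ('f, 'f^2^2) L_alg) n \<sigma>
             = 2 * irr_char [n] \<sigma> + (if n = 1 then 0 else irr_char [n - 1, 1] \<sigma>)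
         \<and> diff_cochar B (M2_delta :: ('f, 'f^2^2) L_alg) n \<sigma>
             = 2 * irr_char [n] \<sigma> + (if n = 1 then 0 else irr_char [n - 1, 1] \<sigma>))"
proof (intro conjI allI impI)
  note B = assms(1)
  have char: "2 * irr_char [n] \<sigma> + (if n = 1 then 0 else irr_char [n - 1, 1] \<sigma>)
      = (of_nat (card {i. i < n \<and> \<sigma> i = i}) + 1 :: 'f)"
    if n: "n \<ge> 1" and \<sigma>: "\<sigma> permutes {..<n}" for n \<sigma>
  proof (cases "n = 1")
    case True
    then have "{i. i < n \<and> \<sigma> i = i} = {0}" using permutes_in_image[OF \<sigma>, of 0] by auto
    then show ?thesis using True irr_char_trivial[OF \<sigma>, where 'f = 'f] by simp
  next
    case False
    then show ?thesis using irr_char_trivial[OF \<sigma>, where 'f = 'f] irr_char_standard[OF _ \<sigma>, where 'f = 'f] n by simp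
  qed
  fix n :: nat assume n: "n \<ge> 1"
  show "diff_codim B (M1_delta :: ('f, 'f^2^2) L_alg) n = n + 1"
    "diff_codim B (M2_delta :: ('f, 'f^2^2) L_alg) n = n + 1"
    by (rule codim_cochar_M1[OF B n] codim_cochar_M2[OF B n])+
  fix \<sigma> assume \<sigma>: "\<sigma> permutes {..<n}"
  show "diff_cochar B (M1_delta :: ('f, 'f^2^2) L_alg) n \<sigma>
      = 2 * irr_char [n] \<sigma> + (if n = 1 then 0 else irr_char [n - 1, 1] \<sigma>)"
    "diff_cochar B (M2_delta :: ('f, 'f^2^2) L_alg) n \<sigma>
      = 2 * irr_char [n] \<sigma> + (if n = 1 then 0 else irr_char [n - 1, 1] \<sigma>)"
    using codim_cochar_M1(2)[OF B n \<sigma>] codim_cochar_M2(2)[OF B n \<sigma>] char[OF n \<sigma>] by simp_all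
qed (use assms diff_Id_M1 diff_Id_M2 in blast)+

end
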